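(* Let $X$ be a real random variable with CDF $F_0$ and moment generating function $M_0(\theta)=E[e^{\theta X}]$ whose convergence strip is $\theta\in(-\alpha,\beta)$, where $0<\alpha,\beta\le\infty$; for complex $s$ with $-\alpha<\operatorname{Re}s<\beta$ put $M_0(s)=E[e^{sX}]$. Suppose that $F_0$ is absolutely continuous with density $f_0$, and assume that for some $c\in(-\alpha,\beta)$ there exists $\nu(c)\in(0,\infty)$ such that $$\int_{t\in\mathbb{R}}|M_0(c+it)|^{1+\nu(c)}\,dt<\infty .$$ For $y\in\mathbb{R}$ define $$\Xi_1(\theta,y)=\frac{1}{2\pi i}\int_{c_1-i\infty}^{c_1+i\infty}M_0(s)\frac{e^{(\theta-s)y}}{\theta-s}\,ds,\qquad \theta\in(-\alpha,\infty),\quad -\alpha<c_1<\min(\beta,\theta),$$ $$\Xi_2(\theta,y)=\frac{1}{2\pi i}\int_{c_2-i\infty}^{c_2+i\infty}M_0(s)\frac{e^{(\theta-s)y}}{s-\theta}\,ds,\qquad \theta\in(-\infty,\beta),\quad \max(-\alpha,\theta)<c_2<\beta .$$ Then, for every $y\in\mathbb{R}$ and every admissible choice of $c_1,c_2$, the following hold. (i) $$\Xi_1(\theta,y)=\int_{-\infty}^{y}e^{\theta x}f_0(x)\,dx,\quad \theta\in(-\alpha,\infty),\qquad \Xi_2(\theta,y)=\int_{y}^{\infty}e^{\theta x}f_0(x)\,dx,\quad \theta\in(-\infty,\beta),$$ and hence $\Xi_1(\theta,y)+\Xi_2(\theta,y)=M_0(\theta)$ for $\theta\in(-\alpha,\beta)$.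 (ii) For $\theta\neq0$ let $E$ denote an exponential random variable with rate parameter $|\theta|$ which is independent of $X$. When $\theta>0$, $$\Xi_1(\theta,y)=\theta^{-1}e^{\theta y}f_{X+E}(y),$$ and when $-\alpha<\theta<0$, $$\Xi_1(\theta,y)=M_0(\theta)-|\theta|^{-1}e^{\theta y}f_{X-E}(y).$$ (iii) With $E$ as in (ii), when $0<\theta<\beta$, $$\Xi_2(\theta,y)=M_0(\theta)-\theta^{-1}e^{\theta y}f_{X+E}(y),$$ and when $\theta<0$, $$\Xi_2(\theta,y)=|\theta|^{-1}e^{\theta y}f_{X-E}(y).$$ (iv) If $F_0(y)>0$, then $\mathcal{M}_{(-\infty,y)}(\theta)=\Xi_1(\theta,y)/F_0(y)$ for $\theta\in(-\alpha,\infty)$; if $F_0(y)<1$, then $\mathcal{M}_{(y,\infty)}(\theta)=\Xi_2(\theta,y)/\{1-F_0(y)\}$ for $\theta\in(-\infty,\beta)$. (v) For real $a<b$ with $F_0(b)-F_0(a)>0$, $$\mathcal{M}_{(a,b)}(\theta)=\frac{\Xi_1(\theta,b)-\Xi_1(\theta,a)}{F_0(b)-F_0(a)},\qquad \theta\in(-\alpha,\infty),$$ and $$\mathcal{M}_{(a,b)}(\theta)=\frac{\Xi_2(\theta,a)-\Xi_2(\theta,b)}{F_0(b)-F_0(a)},\qquad \theta\in(-\infty,\beta).$$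
   Context: "Convergence strip $(-\alpha,\beta)$" means that $M_0(\theta)<\infty$ for real $\theta\in(-\alpha,\beta)$, this being the (open) interval of convergence of the MGF. For $-\infty\le a<b\le\infty$ with $F_0(b)-F_0(a)>0$ (where $F_0(-\infty)=0$, $F_0(\infty)=1$), $\mathcal{M}_{(a,b)}$ denotes the moment generating function of $X$ conditioned to lie in $(a,b)$: $$\mathcal{M}_{(a,b)}(\theta)=\frac{1}{F_0(b)-F_0(a)}\int_a^b e^{\theta x}\,dF_0(x).$$ $f_Z$ denotes the density of a random variable $Z$. The densities of $X+E$ and $X-E$ at a point are those given by the convolution formula, i.e. $f_{X+E}(y)=\int_{-\infty}^{y}|\theta|e^{-|\theta|(y-u)}f_0(u)\,du$ and $f_{X-E}(y)=\int_{y}^{\infty}|\theta|e^{-|\theta|(u-y)}f_0(u)\,du$ (the continuous versions). *)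

theory Defs
  imports "HOL-Probability.Probability"
begin

(* Used both for real arguments and for complex ones. As a Bochner integral it is 0 where
   E[e^(sX)] does not converge. *)
definition mgf ::
  "'a measure \<Rightarrow> ('a \<Rightarrow> real) \<Rightarrow> 'b \<Rightarrow> 'b::{real_normed_field, banach, second_countable_topology}"
  where "mgf M X s = (\<integral>\<omega>. exp (s * of_real (X \<omega>)) \<partial>M)"

(* The set of real convergence points is an interval; taking its interior leaves open whether
   the MGF converges at a finite endpoint of the strip. *)
definition convergence_strip :: "'a measure \<Rightarrow> ('a \<Rightarrow> real) \<Rightarrow> ereal \<Rightarrow> ereal \<Rightarrow> bool"
  where "convergence_strip M X \<alpha> \<beta> \<longleftrightarrow>
    interior {\<theta>::real. integrable M (\<lambda>\<omega>. exp (\<theta> * X \<omega>))} = einterval (- \<alpha>) \<beta>"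

(* Integrals from c - i*infinity to c + i*infinity, with s = c + i*t and ds = i dt, read as
   absolutely convergent Lebesgue integrals over t. *)
definition vline_integrable :: "(complex \<Rightarrow> complex) \<Rightarrow> real \<Rightarrow> bool"
  where "vline_integrable g c \<longleftrightarrow> integrable lborel (\<lambda>t. g (Complex c t))"

definition vline_integral :: "(complex \<Rightarrow> complex) \<Rightarrow> real \<Rightarrow> complex"
  where "vline_integral g c = \<i> * (LBINT t. g (Complex c t))"

definition Xi1_integrand :: "'a measure \<Rightarrow> ('a \<Rightarrow> real) \<Rightarrow> real \<Rightarrow> real \<Rightarrow> complex \<Rightarrow> complex"
  where "Xi1_integrand M X \<theta> y s =
    mgf M X s * (exp ((of_real \<theta> - s) * of_real y) / (of_real \<theta> - s))"

definition Xi2_integrand :: "'a measure \<Rightarrow> ('a \<Rightarrow> real) \<Rightarrow> real \<Rightarrow> real \<Rightarrow> complex \<Rightarrow> complex"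
  where "Xi2_integrand M X \<theta> y s =
    mgf M X s * (exp ((of_real \<theta> - s) * of_real y) / (s - of_real \<theta>))"

(* The abscissa c of the line of integration is an explicit argument. *)
definition Xi1 :: "'a measure \<Rightarrow> ('a \<Rightarrow> real) \<Rightarrow> real \<Rightarrow> real \<Rightarrow> real \<Rightarrow> complex"
  where "Xi1 M X c \<theta> y = 1 / (2 * of_real pi * \<i>) * vline_integral (Xi1_integrand M X \<theta> y) c"

definition Xi2 :: "'a measure \<Rightarrow> ('a \<Rightarrow> real) \<Rightarrow> real \<Rightarrow> real \<Rightarrow> real \<Rightarrow> complex"
  where "Xi2 M X c \<theta> y = 1 / (2 * of_real pi * \<i>) * vline_integral (Xi2_integrand M X \<theta> y) c"

(* Pointwise versions of the densities of X + E and X - E, for X with density f and an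
   independent exponential E with rate l. *)
definition density_plus_exp :: "real \<Rightarrow> (real \<Rightarrow> real) \<Rightarrow> real \<Rightarrow> real"
  where "density_plus_exp l f y = (LBINT u:{..y}. l * exp (- l * (y - u)) * f u)"

definition density_minus_exp :: "real \<Rightarrow> (real \<Rightarrow> real) \<Rightarrow> real \<Rightarrow> real"
  where "density_minus_exp l f y = (LBINT u:{y..}. l * exp (- l * (u - y)) * f u)"

definition cdf_ext :: "real measure \<Rightarrow> ereal \<Rightarrow> real"
  where "cdf_ext D x = (case x of ereal r \<Rightarrow> cdf D r | PInfty \<Rightarrow> 1 | MInfty \<Rightarrow> 0)"

(* MGF of X conditioned to lie in (a,b); dF_0 is the law of X. *)
definition cond_mgf :: "'a measure \<Rightarrow> ('a \<Rightarrow> real) \<Rightarrow> ereal \<Rightarrow> ereal \<Rightarrow> real \<Rightarrow> real"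
  where "cond_mgf M X a b \<theta> =
    1 / (cdf_ext (distr M borel X) b - cdf_ext (distr M borel X) a) *
    (LINT x:einterval a b|distr M borel X. exp (\<theta> * x))"

end

theory Submission
  imports Defs "HOL-Complex_Analysis.Complex_Analysis" "HOL-Real_Asymp.Real_Asymp"
begin

text \<open>Put d = theta - c1 > 0. On the line Re s = c1 the factor M(s) / (theta - s) is the Fourier transform
  of the convolution h of exp(c1 x) f(x) with the kernel exp(-d x) on the half-line x >= 0. Since h is
  bounded and continuous and exp(d y) h(y) is the integral of exp(theta x) f(x) up to y, Fourier inversion
  gives the formula for Xi1 as soon as M(s) / (theta - s) is absolutely integrable on the line. On
  the line Re s = c this follows from the integrability hypothesis by Hoelder's inequality. Every other
  line of the strip lies between that line and a line on which M is bounded, and the three lines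
  theorem transfers the integrability. Reflecting X turns Xi2 into Xi1 and X - E into a sum; the
  remaining identities split integrals at a point.\<close>

subsection \<open>The moment generating function in the complex strip\<close>

text \<open>The identities are claimed at every \<open>y\<close>, while the density may be
  discontinuous or unbounded; inversion is therefore applied to its smoothing \<open>h\<close>,
  which is continuous. The lines of integration are treated one at a time and never deformed into
  one another, so no residue at \<theta> arises and no decay along horizontal segments is called
  for. The price is that absolute integrability must be obtained on each line from a hypothesis
  about a single one. On a general line only boundedness of M(s) is at hand, and 1/|t| just fails to
  be integrable. Hoelder's inequality, however, leaves a margin: on Re s = c a weight with some
  exponent below 1 is enough. Raising the exponent linearly across the strip turns this margin into
  an exponent above 1 on the far line and exactly 1 on the line wanted. Since the three lines
  theorem bounds moduli of holomorphic functions and not L1 norms, it is applied to the integral of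
  the weighted M against a fixed test function of t, of modulus at most 1, which nearly recovers the
  L1 norm on the middle line.\<close>

text \<open>Dividing by 1 + eps z makes f small at both ends of the strip while its norm on the strip does not
  increase, so that the maximum modulus principle applies to long rectangles.\<close>
lemma bounded_strip_le_edges:
  fixes f :: "complex \<Rightarrow> complex"
  assumes S: "open S" "{z. 0 \<le> Re z \<and> Re z \<le> 1} \<subseteq> S" and hol: "f holomorphic_on S"
    and bdd: "\<And>z. 0 \<le> Re z \<Longrightarrow> Re z \<le> 1 \<Longrightarrow> norm (f z) \<le> K"
    and edges: "\<And>z. Re z = 0 \<or> Re z = 1 \<Longrightarrow> norm (f z) \<le> B" and "0 < B"
    and z: "0 \<le> Re z" "Re z \<le> 1"
  shows "norm (f z) \<le> B"
proof -
  have K: "0 \<le> K" using order_trans[OF norm_ge_zero bdd[of 0]] by simp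
  have main: "norm (f z) \<le> B * norm (1 + of_real \<epsilon> * z)" if \<epsilon>: "0 < \<epsilon>" for \<epsilon>
  proof -
    define g where "g = (\<lambda>z. f z / (1 + of_real \<epsilon> * z))"
    \<comment> \<open>The first term forces \<open>K / (\<epsilon> * R) \<le> B\<close>, the
      estimate for the horizontal sides; the second puts \<open>z\<close> inside the
      rectangle.\<close>
    define R where "R = max (K / (\<epsilon> * B)) \<bar>Im z\<bar> + 1"
    have R: "K / (\<epsilon> * B) < R" "\<bar>Im z\<bar> < R" "0 < R"
      by (auto simp: R_def)
    have ge1: "1 \<le> norm (1 + of_real \<epsilon> * w)" if "0 \<le> Re w" for w :: complex
    proof -
      have "1 \<le> Re (1 + of_real \<epsilon> * w)" using that \<epsilon> by simp
      also have "\<dots> \<le> norm (1 + of_real \<epsilon> * w)" by (rule complex_Re_le_cmod)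
      finally show ?thesis .
    qed
    let ?Q = "cbox (Complex 0 (-R)) (Complex 1 R)"
    have Q: "w \<in> ?Q \<longleftrightarrow> 0 \<le> Re w \<and> Re w \<le> 1 \<and> -R \<le> Im w \<and> Im w \<le> R" for w
      by (auto simp: in_cbox_complex_iff)
    have iQ: "w \<in> interior ?Q \<longleftrightarrow> 0 < Re w \<and> Re w < 1 \<and> -R < Im w \<and> Im w < R" for w
      by (auto simp: in_box_complex_iff)
    have holg: "g holomorphic_on ?Q"
      unfolding g_def
    proof (intro holomorphic_intros)
      show "f holomorphic_on ?Q"
        by (rule holomorphic_on_subset[OF hol]) (use S(2) in \<open>auto simp: Q\<close>)
      show "1 + of_real \<epsilon> * w \<noteq> 0" if "w \<in> ?Q" for w
        using ge1[of w] that unfolding Q by force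
    qed
    have "norm (g z) \<le> B"
    proof (rule maximum_modulus_frontier[where S = ?Q and f = g and \<xi> = z])
      show "g holomorphic_on interior ?Q"
        using holg holomorphic_on_subset interior_subset by blast
      show "continuous_on (closure ?Q) g"
        using holg by (simp add: holomorphic_on_imp_continuous_on)
      show "bounded ?Q" by simp
      show "z \<in> ?Q" unfolding Q using R(2) z by linarith
      fix w assume "w \<in> frontier ?Q"
      hence w: "w \<in> ?Q" "w \<notin> interior ?Q" unfolding frontier_def closure_cbox by blast+
      have ge: "1 \<le> norm (1 + of_real \<epsilon> * w)" using w(1) unfolding Q by (intro ge1) simp
      consider "Re w = 0 \<or> Re w = 1" | "\<bar>Im w\<bar> = R"
        using w Q[of w] iQ[of w] by linarith
      thus "norm (g w) \<le> B"
      proof cases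
        case 1
        have "norm (g w) \<le> norm (f w) / 1"
          unfolding g_def norm_divide using ge by (intro divide_left_mono) auto
        thus ?thesis using edges[OF 1] by simp
      next
        case 2
        have "\<epsilon> * R = \<bar>Im (1 + of_real \<epsilon> * w)\<bar>" using 2 \<epsilon> by (simp add: abs_mult)
        also have "\<dots> \<le> norm (1 + of_real \<epsilon> * w)" by (rule abs_Im_le_cmod)
        finally have le: "\<epsilon> * R \<le> norm (1 + of_real \<epsilon> * w)" .
        have "norm (f w) \<le> K" using w(1) unfolding Q by (intro bdd) simp_all
        hence "norm (g w) \<le> K / (\<epsilon> * R)"
          unfolding g_def norm_divide using le \<epsilon> R(3) K by (intro frac_le) simp_all
        also have "\<dots> \<le> B"
          using R(1,3) \<epsilon> \<open>0 < B\<close> by (simp add: field_simps)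
        finally show ?thesis .
      qed
    qed
    thus ?thesis
      using ge1[OF z(1)] by (simp add: g_def norm_divide divide_le_eq split: if_splits)
  qed
  \<comment> \<open>No trace of the rectangle is left in \<open>main\<close>, so \<epsilon> can tend
    to 0 with \<open>z\<close> fixed.\<close>
  have "((\<lambda>\<epsilon>. B * norm (1 + of_real \<epsilon> * z)) \<longlongrightarrow> B * norm (1 + of_real 0 * z)) (at_right 0)"
    by (intro tendsto_intros)
  hence "norm (f z) \<le> B * norm (1 + of_real 0 * z)"
    by (rule tendsto_lowerbound) (auto simp: eventually_at_right_less eventually_at_filter main)
  thus ?thesis by simp
qed

lemma exp_mult_le_sum:
  fixes x :: real
  assumes "a \<le> \<theta>" "\<theta> \<le> b"
  shows "exp (\<theta> * x) \<le> exp (a * x) + exp (b * x)"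
proof (cases "0 \<le> x")
  case True
  hence "exp (\<theta> * x) \<le> exp (b * x)" using assms by (simp add: mult_right_mono)
  thus ?thesis using exp_ge_zero[of "a * x"] by linarith
next
  case False
  hence "exp (\<theta> * x) \<le> exp (a * x)" using assms by (simp add: mult_right_mono_neg)
  thus ?thesis using exp_ge_zero[of "b * x"] by linarith
qed

lemma integrable_exp_between:
  fixes X :: "'a \<Rightarrow> real"
  assumes [measurable]: "X \<in> borel_measurable M"
    and "integrable M (\<lambda>\<omega>. exp (a * X \<omega>))" "integrable M (\<lambda>\<omega>. exp (b * X \<omega>))"
    and "a \<le> \<theta>" "\<theta> \<le> b"
  shows "integrable M (\<lambda>\<omega>. exp (\<theta> * X \<omega>))"
proof (rule Bochner_Integration.integrable_bound)
  show "integrable M (\<lambda>\<omega>. exp (a * X \<omega>) + exp (b * X \<omega>))" using assms by simp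
  show "AE \<omega> in M. norm (exp (\<theta> * X \<omega>)) \<le> norm (exp (a * X \<omega>) + exp (b * X \<omega>))"
    using exp_mult_le_sum[OF assms(4,5)] by (intro AE_I2) auto
qed auto

lemma norm_exp_mult_of_real: "norm (exp (s * complex_of_real x)) = exp (Re s * x)"
  by simp

lemma integrable_cexp:
  fixes X :: "'a \<Rightarrow> real"
  assumes [measurable]: "X \<in> borel_measurable M" and "integrable M (\<lambda>\<omega>. exp (Re s * X \<omega>))"
  shows "integrable M (\<lambda>\<omega>. exp (s * complex_of_real (X \<omega>)))"
  by (rule Bochner_Integration.integrable_bound[OF assms(2)]) auto

lemma mgf_real: "mgf M X (\<theta> :: real) = (\<integral>\<omega>. exp (\<theta> * X \<omega>) \<partial>M)"
  by (simp add: mgf_def)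

lemma norm_mgf_le: "norm (mgf M X (s :: complex)) \<le> mgf M X (Re s)"
proof -
  have "norm (mgf M X s) \<le> (\<integral>\<omega>. norm (exp (s * complex_of_real (X \<omega>))) \<partial>M)"
    unfolding mgf_def by (rule integral_norm_bound)
  thus ?thesis by (simp add: mgf_def)
qed

lemma mgf_le_sum:
  fixes X :: "'a \<Rightarrow> real" and a b \<theta> :: real
  assumes [measurable]: "X \<in> borel_measurable M"
    and int: "integrable M (\<lambda>\<omega>. exp (a * X \<omega>))" "integrable M (\<lambda>\<omega>. exp (b * X \<omega>))"
    and \<theta>: "a \<le> \<theta>" "\<theta> \<le> b"
  shows "mgf M X \<theta> \<le> mgf M X a + mgf M X b"
proof -
  have "mgf M X \<theta> \<le> (\<integral>\<omega>. exp (a * X \<omega>) + exp (b * X \<omega>) \<partial>M)"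
    unfolding mgf_real
    using int integrable_exp_between[OF assms] exp_mult_le_sum[OF \<theta>]
    by (intro integral_mono) auto
  thus ?thesis using int by (simp add: mgf_def)
qed

text \<open>Mean value inequality on the disc of radius \<open>norm w\<close>, where the derivative
  of exp is at most \<open>exp (norm w)\<close>. It controls the difference quotients of the
  MGF.\<close>

lemma norm_exp_minus_one_le: "norm (exp w - 1) \<le> norm w * exp (norm w)" for w :: complex
proof -
  have "norm (exp w - exp 0) \<le> exp (norm w) * norm (w - 0)"
  proof (rule field_differentiable_bound[where S = "cball 0 (norm w)" and f' = exp])
    show "(exp has_field_derivative exp z) (at z within cball 0 (norm w))" for z :: complex
      by (rule DERIV_subset[OF DERIV_exp]) auto
    show "norm (exp z) \<le> exp (norm w)" if "z \<in> cball 0 (norm w)" for z :: complex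
      using that norm_exp[of z] by (simp add: order_trans)
  qed auto
  thus ?thesis by (simp add: mult.commute)
qed

text \<open>Differentiation under the integral by dominated convergence. The strip is open, so some
  exponential room on both sides of \<open>z\<close> absorbs the factor \<open>X\<close> produced by
  the derivative.\<close>

lemma holomorphic_on_mgf:
  fixes X :: "'a \<Rightarrow> real"
  assumes [measurable]: "X \<in> borel_measurable M"
    and int: "integrable M (\<lambda>\<omega>. exp (a * X \<omega>))" "integrable M (\<lambda>\<omega>. exp (b * X \<omega>))"
  shows "(mgf M X :: complex \<Rightarrow> complex) holomorphic_on {s. a < Re s \<and> Re s < b}"
proof (rule holomorphic_onI, rule field_differentiable_at_within)
  fix z assume z: "z \<in> {s. a < Re s \<and> Re s < b}"
  \<comment> \<open>Half the distance to the nearer edge: one \<open>r\<close> pays for the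
    increment \<open>h\<close>, the other for the factor |x|, through r|x| \<le> exp (r|x|).\<close>
  define r where "r = min (Re z - a) (b - Re z) / 2"
  have r: "0 < r" "a \<le> Re z - 2 * r" "Re z + 2 * r \<le> b" using z by (auto simp: r_def min_def)
  have iE: "integrable M (\<lambda>\<omega>. exp (t * X \<omega>))" if "a \<le> t" "t \<le> b" for t
    using integrable_exp_between[OF assms that] .
  let ?D = "\<integral>\<omega>. of_real (X \<omega>) * exp (z * of_real (X \<omega>)) \<partial>M"
  let ?q = "\<lambda>h \<omega>. (exp ((z + h) * of_real (X \<omega>)) - exp (z * of_real (X \<omega>))) / h"
  let ?w = "\<lambda>\<omega>. 1 / r * (exp ((Re z + 2 * r) * X \<omega>) + exp ((Re z - 2 * r) * X \<omega>))"
  have qbound: "norm (?q h \<omega>) \<le> ?w \<omega>" if h: "h \<noteq> 0" "norm h < r" for h \<omega>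
  proof -
    let ?x = "X \<omega>"
    have "norm (?q h \<omega>) = exp (Re z * ?x) * (norm (exp (h * of_real ?x) - 1) / norm h)"
    proof -
      have "?q h \<omega> = exp (z * of_real ?x) * ((exp (h * of_real ?x) - 1) / h)"
        by (simp add: exp_add algebra_simps)
      thus ?thesis by (simp only: norm_mult norm_divide norm_exp_mult_of_real times_divide_eq_right)
    qed
    also have "\<dots> \<le> exp (Re z * ?x) * (1 / r * (exp (2 * r * ?x) + exp (- 2 * r * ?x)))"
    proof (intro mult_left_mono)
      have "norm (exp (h * of_real ?x) - 1) / norm h \<le> \<bar>?x\<bar> * exp (norm h * \<bar>?x\<bar>)"
        using norm_exp_minus_one_le[of "h * of_real ?x"] h by (simp add: norm_mult divide_simps mult_ac)
      also have "\<dots> \<le> \<bar>?x\<bar> * exp (r * \<bar>?x\<bar>)"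
        using h by (intro mult_left_mono) (auto intro!: mult_right_mono)
      also have "\<dots> \<le> 1 / r * exp (r * \<bar>?x\<bar>) * exp (r * \<bar>?x\<bar>)"
      proof (intro mult_right_mono)
        have "r * \<bar>?x\<bar> \<le> exp (r * \<bar>?x\<bar>)" using exp_ge_add_one_self[of "r * \<bar>?x\<bar>"] by linarith
        thus "\<bar>?x\<bar> \<le> 1 / r * exp (r * \<bar>?x\<bar>)" using r by (simp add: field_simps)
      qed auto
      also have "\<dots> = 1 / r * exp (2 * r * \<bar>?x\<bar>)" by (simp flip: exp_add)
      also have "\<dots> \<le> 1 / r * (exp (2 * r * ?x) + exp (- 2 * r * ?x))"
        using r by (intro mult_left_mono) (cases "0 \<le> ?x", auto)
      finally show "norm (exp (h * of_real ?x) - 1) / norm h \<le> 1 / r * (exp (2 * r * ?x) + exp (- 2 * r * ?x))" .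
    qed auto
    also have "\<dots> = ?w \<omega>"
      by (simp add: field_simps flip: exp_add)
    finally show ?thesis .
  qed
  have "((\<lambda>h. (mgf M X (z + h) - mgf M X z) / h) \<longlongrightarrow> ?D) (at 0)"
    unfolding tendsto_at_iff_sequentially
  proof (intro allI impI)
    fix h :: "nat \<Rightarrow> complex" assume h: "\<forall>i. h i \<in> UNIV - {0}" "h \<longlonglongrightarrow> 0"
    have h0: "h i \<noteq> 0" for i using h by auto
    from h(2) r have ev: "\<forall>\<^sub>F i in sequentially. norm (h i) < r"
      by (simp add: tendsto_iff)
    \<comment> \<open>The dominating function works only for increments shorter than
      \<open>r\<close>, hence the shift of the sequence by \<open>N\<close>.\<close>
    then obtain N where N: "\<And>i. i \<ge> N \<Longrightarrow> norm (h i) < r" by (auto simp: eventually_sequentially)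
    have eq: "(mgf M X (z + h i) - mgf M X z) / h i = (\<integral>\<omega>. ?q (h i) \<omega> \<partial>M)" if "i \<ge> N" for i
    proof -
      have "\<bar>Re (h i)\<bar> < r" using N[OF that] abs_Re_le_cmod[of "h i"] by linarith
      hence "integrable M (\<lambda>\<omega>. exp ((z + h i) * of_real (X \<omega>)))"
        using r by (intro integrable_cexp iE) auto
      moreover have "integrable M (\<lambda>\<omega>. exp (z * of_real (X \<omega>)))"
        using r by (intro integrable_cexp iE) auto
      ultimately show ?thesis by (simp add: mgf_def)
    qed
    have "(\<lambda>i. \<integral>\<omega>. ?q (h (i + N)) \<omega> \<partial>M) \<longlonglongrightarrow> ?D"
    proof (rule integral_dominated_convergence[where w = ?w])
      show "integrable M ?w" using r by (intro integrable_mult_right Bochner_Integration.integrable_add iE) auto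
      show "AE \<omega> in M. norm (?q (h (i + N)) \<omega>) \<le> ?w \<omega>" for i
        using qbound[of "h (i + N)"] h0 N by auto
      show "AE \<omega> in M. (\<lambda>i. ?q (h (i + N)) \<omega>) \<longlonglongrightarrow> of_real (X \<omega>) * exp (z * of_real (X \<omega>))"
      proof (rule AE_I2)
        fix \<omega>
        have "((\<lambda>s. exp (s * of_real (X \<omega>))) has_field_derivative
                of_real (X \<omega>) * exp (z * of_real (X \<omega>))) (at z)"
          by (auto intro!: derivative_eq_intros)
        hence "((\<lambda>h. ?q h \<omega>) \<longlongrightarrow> of_real (X \<omega>) * exp (z * of_real (X \<omega>))) (at 0)"
          by (simp add: DERIV_def)
        moreover have "(\<lambda>i. h (i + N)) \<longlonglongrightarrow> 0" using h(2) by (rule LIMSEQ_ignore_initial_segment)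
        ultimately show "(\<lambda>i. ?q (h (i + N)) \<omega>) \<longlonglongrightarrow> of_real (X \<omega>) * exp (z * of_real (X \<omega>))"
          using h0 by (auto simp: tendsto_at_iff_sequentially o_def)
      qed
    qed auto
    hence "(\<lambda>i. (mgf M X (z + h (i + N)) - mgf M X z) / h (i + N)) \<longlonglongrightarrow> ?D"
      by (simp add: eq)
    thus "((\<lambda>h. (mgf M X (z + h) - mgf M X z) / h) \<circ> h) \<longlonglongrightarrow> ?D"
      unfolding o_def by (rule LIMSEQ_offset)
  qed
  hence "(mgf M X has_field_derivative ?D) (at z)" by (simp add: DERIV_def)
  thus "(mgf M X :: complex \<Rightarrow> complex) field_differentiable at z"
    by (auto simp: field_differentiable_def)
qed

subsection \<open>Change of the line of integration\<close>

lemma integrable_one_plus_abs_powr: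
  fixes a :: real
  assumes "1 < a"
  shows "integrable lborel (\<lambda>t::real. (1 + \<bar>t\<bar>) powr - a)"
proof -
  let ?F = "\<lambda>t::real. - ((1 + t) powr (1 - a)) / (a - 1)"
  let ?g = "\<lambda>t::real. indicator {0..} t *\<^sub>R (1 + \<bar>t\<bar>) powr - a"
  have "(\<integral>\<^sup>+t. ennreal ((1 + \<bar>t\<bar>) powr - a) * indicator {0..} t \<partial>lborel) = ennreal (0 - ?F 0)"
  proof (rule nn_integral_FTC_atLeast)
    fix t :: real assume t: "0 \<le> t"
    have "((\<lambda>t. (1 + t) powr (1 - a)) has_real_derivative (1 - a) * (1 + t) powr (1 - a - 1) * 1) (at t)"
      by (rule DERIV_chain2[OF has_real_derivative_powr])
         (use t in \<open>auto intro!: derivative_eq_intros\<close>)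
    from DERIV_cdivide[OF DERIV_minus[OF this], of "a - 1"]
    have "(?F has_real_derivative - ((1 - a) * (1 + t) powr (1 - a - 1) * 1) / (a - 1)) (at t)" .
    also have "- ((1 - a) * (1 + t) powr (1 - a - 1) * 1) / (a - 1) = (1 + t) powr - a"
      using assms by (simp add: divide_eq_eq algebra_simps)
    finally have "(?F has_real_derivative (1 + t) powr - a) (at t)" .
    thus "(?F has_real_derivative (1 + \<bar>t\<bar>) powr - a) (at t)" using t by simp
  next
    show "(?F \<longlongrightarrow> 0) at_top" using assms by real_asymp
  qed auto
  hence "integrable lborel ?g"
    by (intro integrableI_nonneg) (auto simp: indicator_mult_ennreal mult.commute)
  moreover from lborel_integrable_real_affine[OF this, of "-1" 0]
  have "integrable lborel (\<lambda>t. ?g (- t))" by simp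
  \<comment> \<open>At t = 0 both summands contribute, so the sum dominates the function without
    being equal to it.\<close>
  ultimately have "integrable lborel (\<lambda>t. ?g t + ?g (- t))" by simp
  thus ?thesis
    by (rule Bochner_Integration.integrable_bound) (auto simp: indicator_def)
qed

text \<open>Young's inequality for the conjugate exponents \<open>1 + \<nu>\<close> and
  \<open>1 + 1 / \<nu>\<close>, with constants 1: whichever of \<open>w\<close> and
  \<open>x powr \<nu>\<close> is larger, one of the two terms already suffices.\<close>

lemma mult_le_powr_add_powr:
  fixes x w \<nu> :: real
  assumes "0 \<le> x" "0 \<le> w" "0 < \<nu>"
  shows "x * w \<le> x powr (1 + \<nu>) + w powr (1 + 1 / \<nu>)"
proof (cases "w \<le> x powr \<nu>")
  case True
  hence "x * w \<le> x * x powr \<nu>" using assms by (intro mult_left_mono)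
  also have "\<dots> = x powr (1 + \<nu>)" using assms by (cases "x = 0") (auto simp: powr_add)
  finally show ?thesis by (simp add: add_increasing2)
next
  case False
  have "x = (x powr \<nu>) powr (1 / \<nu>)" using assms by (simp add: powr_powr)
  also have "\<dots> \<le> w powr (1 / \<nu>)" using False assms by (intro powr_mono2) auto
  finally have "x * w \<le> w powr (1 / \<nu>) * w" using assms by (intro mult_right_mono)
  also have "\<dots> = w powr (1 + 1 / \<nu>)" using assms by (cases "w = 0") (auto simp: powr_add)
  finally show ?thesis by (simp add: add_increasing)
qed

text \<open>Monotone convergence. The interpolation argument works on compact intervals, where
  differentiation under the integral is easy, and yields a bound uniform in their length.\<close>

lemma integrable_of_bounded_interval_integrals:
  fixes g :: "real \<Rightarrow> real"
  assumes cont: "continuous_on UNIV g" and nonneg: "\<And>t. 0 \<le> g t"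
    and bound: "\<And>n::nat. integral {- real n..real n} g \<le> C"
  shows "integrable lborel g"
proof -
  let ?f = "\<lambda>n t. indicator {- real n..real n} t *\<^sub>R g t"
  have [measurable]: "g \<in> borel_measurable borel"
    using cont by (rule borel_measurable_continuous_onI)
  have si: "set_integrable lborel {- real n..real n} g" for n
    by (rule borel_integrable_atLeastAtMost') (rule continuous_on_subset[OF cont], simp)
  have int: "integrable lborel (?f n)" for n using si[of n] by (simp add: set_integrable_def)
  have eq: "integral\<^sup>L lborel (?f n) = integral {- real n..real n} g" for n
    using set_borel_integral_eq_integral(2)[OF si[of n]] by (simp add: set_lebesgue_integral_def)
  have mono: "incseq (\<lambda>n. integral\<^sup>L lborel (?f n))"
    by (intro incseq_SucI integral_mono int) (auto simp: indicator_def nonneg)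
  obtain L where L: "(\<lambda>n. integral\<^sup>L lborel (?f n)) \<longlonglongrightarrow> L"
    using incseq_convergent[OF mono, of C] bound eq by metis
  show ?thesis
  proof (rule integrable_monotone_convergence[where f = ?f, OF int _ _ L])
    show "AE t in lborel. mono (\<lambda>n. ?f n t)"
      by (auto intro!: AE_I2 monoI simp: indicator_def nonneg)
    show "AE t in lborel. (\<lambda>n. ?f n t) \<longlonglongrightarrow> g t"
    proof (rule AE_I2)
      fix t :: real
      obtain N :: nat where N: "\<bar>t\<bar> \<le> real N" using real_arch_simple by blast
      have "\<forall>\<^sub>F n in sequentially. ?f n t = g t"
        using eventually_ge_at_top[of N] by eventually_elim (use N in \<open>auto simp: indicator_def\<close>)
      thus "(\<lambda>n. ?f n t) \<longlonglongrightarrow> g t" by (rule tendsto_eventually)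
    qed
  qed auto
qed

text \<open>Links the gauge integrals over [-T, T] used for interpolation with Lebesgue integrals
  over the whole line, whose values do not depend on T.\<close>

lemma norm_integral_le_lborel:
  fixes f :: "real \<Rightarrow> complex"
  assumes "f integrable_on {l..u}" "integrable lborel g" "\<And>t. 0 \<le> g t"
    and "\<And>t. t \<in> {l..u} \<Longrightarrow> norm (f t) \<le> g t"
  shows "norm (integral {l..u} f) \<le> (LBINT t. g t)"
proof -
  have g: "g integrable_on UNIV" using assms(2) by (rule integrable_on_lborel)
  hence g': "g integrable_on {l..u}"
    by (rule integrable_on_subinterval) simp
  have "norm (integral {l..u} f) \<le> integral {l..u} g"
    using assms(1) g' assms(4) by (rule integral_norm_bound_integral)
  also have "\<dots> \<le> integral UNIV g"
    using g g' assms(3) by (intro integral_subset_le) auto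
  also have "\<dots> = (LBINT t. g t)" using assms(2) by (rule integral_lborel)
  finally show ?thesis .
qed

text \<open>Interpolation between the line Re z = c, where f is in L^(1+nu), and a line beyond Re z = c',
  where f is bounded. The weight (1 + |t|)^(- e z) has exponent e c < 1 on the former, 1 at c' and
  > 1 on the latter, so that it makes f absolutely integrable on both outer lines; the factor u
  almost cancels the phase of f on the line Re z = c'.\<close>
lemma integrable_vline_weighted:
  fixes f :: "complex \<Rightarrow> complex"
  assumes hol: "f holomorphic_on {z. a < Re z \<and> Re z < b}"
    and bdd: "\<And>z. a < Re z \<Longrightarrow> Re z < b \<Longrightarrow> norm (f z) \<le> K"
    and c: "a < c" "c < b" and c': "a < c'" "c' < b" and \<nu>: "0 < \<nu>"
    and int: "integrable lborel (\<lambda>t. norm (f (Complex c t)) powr (1 + \<nu>))"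
  shows "integrable lborel (\<lambda>t. norm (f (Complex c' t)) * (1 + \<bar>t\<bar>) powr - 1)"
proof -
  let ?S = "{z. a < Re z \<and> Re z < b}"
  \<comment> \<open>Conjugate exponent of \<open>1 + \<nu>\<close>.\<close>
  define q where "q = 1 + 1 / \<nu>"
  have q: "1 < q" using \<nu> by (simp add: q_def)
  have S_open: "open ?S"
    by (intro open_Collect_conj open_halfspace_Re_gt open_halfspace_Re_lt)
  have S_convex: "convex ?S"
    using convex_Int[OF convex_halfspace_Re_gt[of a] convex_halfspace_Re_lt[of b]]
    by (simp add: Collect_conj_eq)
  have contf: "continuous_on ?S f" using hol by (rule holomorphic_on_imp_continuous_on)
  have cont_line: "continuous_on UNIV (\<lambda>t. f (Complex x (t + \<eta>)))" if "a < x" "x < b" for x \<eta>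
    using that by (intro continuous_on_compose2[OF contf] continuous_on_Complex continuous_intros) auto
  have [measurable]: "(\<lambda>t. f (Complex x t)) \<in> borel_measurable borel" if "a < x" "x < b" for x
    using borel_measurable_continuous_onI[OF cont_line[OF that, of 0]] by simp
  have K: "0 \<le> K" using order_trans[OF norm_ge_zero bdd[of "of_real c"]] c by simp
  have w_nonneg: "0 \<le> (1 + \<bar>t\<bar>) powr e" for t e :: real by simp
  \<comment> \<open>Pointwise form of Hoelder's inequality. The points \<open>s\<close> and
    \<open>t\<close> are independent because moving up the edge translates \<open>f\<close> but not
    the weight.\<close>
  have edge: "norm (f (Complex c s)) * (1 + \<bar>t\<bar>) powr - e
       \<le> norm (f (Complex c s)) powr (1 + \<nu>) + (1 + \<bar>t\<bar>) powr - (e * q)" for e s t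
    using mult_le_powr_add_powr[of "norm (f (Complex c s))" "(1 + \<bar>t\<bar>) powr - e" \<nu>] \<nu>
    by (simp add: powr_powr q_def)
  show ?thesis
  \<comment> \<open>On the line of the hypothesis itself there is nothing to interpolate, and the
    width \<open>d\<close> below would vanish.\<close>
  proof (cases "c' = c")
    case True
    have "integrable lborel (\<lambda>t. norm (f (Complex c t)) powr (1 + \<nu>) + (1 + \<bar>t\<bar>) powr - q)"
      using int integrable_one_plus_abs_powr[OF q] by simp
    thus ?thesis
      using c True edge[of _ _ 1] by (elim Bochner_Integration.integrable_bound) auto
  next
    case False
    \<comment> \<open>\<open>c + d\<close> equals \<open>c' + r * (c' - c)\<close>: the second outer
      line passes \<open>c'\<close>, on the side away from \<open>c\<close>, by half the distance
      from \<open>c'\<close> to the nearer edge. If \<open>c' < c\<close> then \<open>d\<close> is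
      negative.\<close>
    define r where "r = min (c' - a) (b - c') / (2 * \<bar>c' - c\<bar>)"
    define d where "d = (1 + r) * (c' - c)"
    have r: "0 < r" using False c' by (simp add: r_def)
    have "\<bar>r * (c' - c)\<bar> < min (c' - a) (b - c')"
      using False c' by (auto simp: r_def abs_mult)
    hence d: "a < c + d" "c + d < b"
      by (auto simp: d_def algebra_simps abs_less_iff)
    have d0: "d \<noteq> 0" using False r by (simp add: d_def)
    have between: "a < c + x * d \<and> c + x * d < b" if "0 \<le> x" "x \<le> 1" for x
    proof -
      have eq: "c + x * d = (1 - x) * c + x * (c + d)" by (simp add: algebra_simps)
      have "c + x * d \<in> {a<..<b}"
        unfolding eq using convexD[OF convex_real_interval(8)[of a b], of c "c + d" "1 - x" x] c d that
        by simp
      thus ?thesis by simp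
    qed
    \<comment> \<open>\<open>e0\<close> is the midpoint of \<open>1 / q\<close> and 1, so
      \<open>e0 * q\<close> exceeds 1 although \<open>e0\<close> does not. The slope
      \<open>\<kappa>\<close> is fixed by requiring exponent 1 at \<open>c'\<close>, which lies at
      the fraction \<open>1 / (1 + r)\<close> of the way from \<open>c\<close> to
      \<open>c + d\<close>.\<close>
    define e0 where "e0 = (1 / q + 1) / 2"
    define \<kappa> where "\<kappa> = (1 - e0) * (1 + r)"
    have e0: "0 < e0" "e0 < 1" "1 < e0 * q" using q by (auto simp: e0_def field_simps)
    have \<kappa>_eq: "e0 + \<kappa> = 1 + (1 - e0) * r" by (simp add: \<kappa>_def algebra_simps)
    have \<kappa>: "0 < \<kappa>" "1 < e0 + \<kappa>" using e0 r by (simp_all add: \<kappa>_eq) (simp add: \<kappa>_def)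
    define ex where "ex z = of_real e0 + of_real \<kappa> * ((z - of_real c) / of_real d)" for z :: complex
    have Re_ex: "Re (ex z) = e0 + \<kappa> * ((Re z - c) / d)" for z
      unfolding ex_def by (simp flip: of_real_diff)
    have ex_c': "ex (of_real c') = 1"
    proof -
      have "\<kappa> * ((c' - c) / d) = 1 - e0"
        using False r by (simp add: \<kappa>_def d_def)
      hence "of_real (e0 + \<kappa> * ((c' - c) / d)) = (1 :: complex)" by simp
      thus ?thesis unfolding ex_def by simp
    qed
    define A' where "A' = (LBINT t. norm (f (Complex c t)) powr (1 + \<nu>)) + (LBINT t. (1 + \<bar>t\<bar>) powr - (e0 * q))"
    define B where "B = (LBINT t. K * (1 + \<bar>t\<bar>) powr - (e0 + \<kappa>))"
    \<comment> \<open>The added 1 makes the bound strictly positive, as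
      \<open>bounded_strip_le_edges\<close> demands.\<close>
    define C where "C = max A' B + 1"
    have B0: "0 \<le> B" unfolding B_def using K by (intro Bochner_Integration.integral_nonneg) auto
    \<comment> \<open>\<open>C\<close> depends on neither \<open>T\<close> nor \<epsilon>; the error
      term disappears when \<epsilon> tends to 0 with \<open>T\<close> fixed, before
      \<open>T\<close> grows.\<close>
    have main: "integral {- T..T} (\<lambda>t. norm (f (Complex c' t)) * (1 + \<bar>t\<bar>) powr - 1) \<le> C + \<epsilon> * (2 * T)"
      if T: "0 \<le> T" and \<epsilon>: "0 < \<epsilon>" for T \<epsilon>
    proof -
      \<comment> \<open>Adding \<epsilon> to the denominator keeps \<open>u\<close> continuous at
        the zeros of \<open>f\<close>. Since \<open>u\<close> is independent of \<open>z\<close>,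
        holomorphy in \<open>z\<close> is preserved.\<close>
      define u where "u t = cnj (f (Complex c' t)) / of_real (norm (f (Complex c' t)) + \<epsilon>)" for t
      have pos: "0 < norm (f (Complex c' t)) + \<epsilon>" for t using \<epsilon> by (simp add: add_nonneg_pos)
      have u_le: "norm (u t) \<le> 1" for t
      proof -
        have "norm (u t) = norm (f (Complex c' t)) / (norm (f (Complex c' t)) + \<epsilon>)"
          unfolding u_def norm_divide complex_mod_cnj norm_of_real using pos[of t] by simp
        thus ?thesis using pos[of t] \<epsilon> by simp
      qed
      have u_cont: "continuous_on UNIV u"
        unfolding u_def using cont_line[OF c', of 0] pos
        by (intro continuous_intros) (auto simp: less_imp_neq[symmetric] simp del: of_real_add)
      \<comment> \<open>The logarithm makes \<open>exp (- ex z * L t)\<close> the weight with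
        complex exponent, holomorphic in \<open>z\<close>; only \<open>Re (ex z)\<close> affects its
        modulus.\<close>
      define L where "L t = complex_of_real (ln (1 + \<bar>t\<bar>))" for t :: real
      have L_cont: "continuous_on UNIV L" unfolding L_def by (intro continuous_intros) auto
      define h where "h z t = f (z + \<i> * of_real t) * (u t * exp (- ex z * L t))" for z t
      define H where "H z = integral (cbox (- T) T) (h z)" for z
      have norm_h: "norm (h z t) \<le> norm (f (z + \<i> * of_real t)) * (1 + \<bar>t\<bar>) powr - Re (ex z)" for z t
      proof -
        have "norm (exp (- ex z * L t)) = (1 + \<bar>t\<bar>) powr - Re (ex z)"
          unfolding L_def norm_exp_mult_of_real by (simp add: powr_def)
        moreover have "norm (u t) * (1 + \<bar>t\<bar>) powr - Re (ex z) \<le> (1 + \<bar>t\<bar>) powr - Re (ex z)"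
          using mult_right_mono[OF u_le w_nonneg] by simp
        ultimately show ?thesis unfolding h_def norm_mult by (simp add: mult_left_mono)
      qed
      have h_cont: "continuous_on (cbox (- T) T) (h z)" if "z \<in> ?S" for z
      proof -
        have "continuous_on (cbox (- T) T) (\<lambda>t. f (z + \<i> * of_real t))"
          using that by (intro continuous_on_compose2[OF contf] continuous_intros) auto
        thus ?thesis unfolding h_def
          by (intro continuous_intros continuous_on_subset[OF u_cont] continuous_on_subset[OF L_cont]) auto
      qed
      have h_int: "h z integrable_on {- T..T}" if "z \<in> ?S" for z
        using integrable_continuous[OF h_cont[OF that]] by simp
      have H_hol: "H holomorphic_on ?S"
        unfolding H_def
      proof (rule leibniz_rule_holomorphic)
        fix z t assume z: "z \<in> ?S"
        have "f field_differentiable at (z + \<i> * of_real t)"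
          using hol S_open z by (auto simp: holomorphic_on_open field_differentiable_def)
        hence D: "(f has_field_derivative deriv f (z + \<i> * of_real t)) (at (z + \<i> * of_real t))"
          by (rule field_differentiable_derivI)
        have "((\<lambda>z. f (z + \<i> * of_real t)) has_field_derivative deriv f (z + \<i> * of_real t) * 1) (at z)"
          by (rule DERIV_chain2[where g = "\<lambda>z. z + \<i> * of_real t", OF D]) (auto intro!: derivative_eq_intros)
        hence F: "((\<lambda>z. f (z + \<i> * of_real t)) has_field_derivative deriv f (z + \<i> * of_real t)) (at z)"
          by simp
        have "(ex has_field_derivative of_real \<kappa> / of_real d) (at z)"
          unfolding ex_def using d0 by (auto intro!: derivative_eq_intros)
        hence "((\<lambda>z. - ex z * L t) has_field_derivative - (of_real \<kappa> / of_real d) * L t) (at z)"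
          by (intro DERIV_cmult_right DERIV_minus)
        hence E: "((\<lambda>z. exp (- ex z * L t)) has_field_derivative
            exp (- ex z * L t) * (- (of_real \<kappa> / of_real d) * L t)) (at z)"
          by (rule DERIV_fun_exp)
        show "((\<lambda>z. h z t) has_field_derivative
            deriv f (z + \<i> * of_real t) * (u t * exp (- ex z * L t)) +
            u t * (exp (- ex z * L t) * (- (of_real \<kappa> / of_real d) * L t)) * f (z + \<i> * of_real t))
            (at z within ?S)"
          unfolding h_def by (rule has_field_derivative_at_within[OF DERIV_mult[OF F DERIV_cmult[OF E]]])
      next
        show "h z integrable_on cbox (- T) T" if "z \<in> ?S" for z
          using integrable_continuous[OF h_cont[OF that]] .
        have cf': "continuous_on ?S (deriv f)"
          using hol S_open by (intro holomorphic_on_imp_continuous_on holomorphic_deriv)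
        let ?P = "?S \<times> cbox (- T) T"
        have 1: "continuous_on ?P (\<lambda>x. f (fst x + \<i> * of_real (snd x)))"
          by (intro continuous_on_compose2[OF contf] continuous_intros) auto
        have 2: "continuous_on ?P (\<lambda>x. deriv f (fst x + \<i> * of_real (snd x)))"
          by (intro continuous_on_compose2[OF cf'] continuous_intros) auto
        have 3: "continuous_on ?P (\<lambda>x. u (snd x))"
          by (intro continuous_on_compose2[OF u_cont] continuous_intros) auto
        have 4: "continuous_on ?P (\<lambda>x. L (snd x))"
          by (intro continuous_on_compose2[OF L_cont] continuous_intros) auto
        show "continuous_on ?P (\<lambda>(z, t).
            deriv f (z + \<i> * of_real t) * (u t * exp (- ex z * L t)) +
            u t * (exp (- ex z * L t) * (- (of_real \<kappa> / of_real d) * L t)) * f (z + \<i> * of_real t))"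
          unfolding ex_def case_prod_unfold using d0
          by (intro continuous_intros 1 2 3 4) auto
      qed (rule S_convex)
      \<comment> \<open>Affine parametrisation of the strip between \<open>c\<close> and
        \<open>c + d\<close>, in either order, by the unit strip.\<close>
      let ?G = "\<lambda>\<zeta>. H (of_real c + \<zeta> * of_real d)"
      let ?V = "(\<lambda>\<zeta>. of_real c + \<zeta> * of_real d) -` ?S"
      have nG: "norm (?G (of_real ((c' - c) / d))) \<le> C"
      proof (rule bounded_strip_le_edges[where f = ?G and S = ?V])
        show "open ?V" using S_open by (intro continuous_open_vimage) (auto intro!: continuous_intros)
        show "{z. 0 \<le> Re z \<and> Re z \<le> 1} \<subseteq> ?V" using between by auto
        show "?G holomorphic_on ?V"
          by (rule holomorphic_on_compose_gen[where g = H, unfolded o_def, OF _ H_hol])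
             (auto intro!: holomorphic_intros)
        show "0 < C" using B0 by (simp add: C_def)
        show "0 \<le> Re (of_real ((c' - c) / d))" "Re (of_real ((c' - c) / d)) \<le> 1"
          using False r by (auto simp: d_def)
        fix \<zeta> :: complex
        let ?z = "of_real c + \<zeta> * of_real d"
        have Re_z: "Re (ex ?z) = e0 + \<kappa> * Re \<zeta>" using d0 by (simp add: Re_ex)
        \<comment> \<open>This crude bound grows with \<open>T\<close>, but it only supplies the
          boundedness hypothesis and does not enter \<open>C\<close>.\<close>
        { assume \<zeta>: "0 \<le> Re \<zeta>" "Re \<zeta> \<le> 1"
          have z: "?z \<in> ?S" using between[OF \<zeta>] by simp
          have "norm (integral (cbox (- T) T) (h ?z)) \<le> K * measure lborel (cbox (- T) T)"
          proof (rule integrable_bound)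
            show "h ?z integrable_on cbox (- T) T" using h_int[OF z] by simp
            fix t assume "t \<in> cbox (- T) T"
            have "norm (h ?z t) \<le> norm (f (?z + \<i> * of_real t)) * (1 + \<bar>t\<bar>) powr - Re (ex ?z)"
              by (rule norm_h)
            also have "\<dots> \<le> K * 1"
            proof (intro mult_mono bdd)
              have "0 \<le> e0 + \<kappa> * Re \<zeta>" using e0 \<kappa> \<zeta> by simp
              hence "(1 + \<bar>t\<bar>) powr - Re (ex ?z) \<le> (1 + \<bar>t\<bar>) powr 0"
                unfolding Re_z by (intro powr_mono) auto
              thus "(1 + \<bar>t\<bar>) powr - Re (ex ?z) \<le> 1" using abs_ge_zero[of t] by simp
            qed (use z K in auto)
            finally show "norm (h ?z t) \<le> K" by simp
          qed (rule K)
          thus "norm (?G \<zeta>) \<le> K * measure lborel (cbox (- T) T)" unfolding H_def . }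
        assume "Re \<zeta> = 0 \<or> Re \<zeta> = 1"
        thus "norm (?G \<zeta>) \<le> C"
        proof
          assume \<zeta>: "Re \<zeta> = 0"
          have z: "?z \<in> ?S" using c \<zeta> by simp
          \<comment> \<open>Moving up the edge merely translates \<open>f\<close> along its line,
            which does not change the integral over the whole line; hence one constant
            \<open>A'\<close> for all \<open>Im \<zeta>\<close>.\<close>
          have zeq: "?z + \<i> * of_real t = Complex c (Im \<zeta> * d + t)" for t
            using \<zeta> by (simp add: complex_eq_iff)
          have i1: "integrable lborel (\<lambda>t. norm (f (Complex c (Im \<zeta> * d + t))) powr (1 + \<nu>))"
            using lborel_integrable_real_affine[OF int, of 1 "Im \<zeta> * d"] by simp
          have e1: "(LBINT t. norm (f (Complex c (Im \<zeta> * d + t))) powr (1 + \<nu>))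
                  = (LBINT t. norm (f (Complex c t)) powr (1 + \<nu>))"
            using lborel_integral_real_affine[of 1 "\<lambda>t. norm (f (Complex c t)) powr (1 + \<nu>)" "Im \<zeta> * d"]
            by simp
          have i2: "integrable lborel (\<lambda>t. (1 + \<bar>t\<bar>) powr - (e0 * q))"
            using e0 by (intro integrable_one_plus_abs_powr)
          have "norm (integral {- T..T} (h ?z)) \<le>
              (LBINT t. norm (f (Complex c (Im \<zeta> * d + t))) powr (1 + \<nu>) + (1 + \<bar>t\<bar>) powr - (e0 * q))"
          proof (rule norm_integral_le_lborel[OF h_int[OF z]])
            show "integrable lborel (\<lambda>t. norm (f (Complex c (Im \<zeta> * d + t))) powr (1 + \<nu>)
                    + (1 + \<bar>t\<bar>) powr - (e0 * q))"
              using i1 i2 by simp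
            show "norm (h ?z t) \<le> norm (f (Complex c (Im \<zeta> * d + t))) powr (1 + \<nu>)
                    + (1 + \<bar>t\<bar>) powr - (e0 * q)" for t
              using order_trans[OF norm_h[of ?z t, unfolded zeq Re_z \<zeta>]] edge[of "Im \<zeta> * d + t" t e0]
              by simp
          qed auto
          also have "\<dots> = A'" unfolding A'_def using i1 i2 e1 by simp
          finally show ?thesis unfolding H_def C_def by simp
        next
          assume \<zeta>: "Re \<zeta> = 1"
          have z: "?z \<in> ?S" using d \<zeta> by simp
          have "norm (integral {- T..T} (h ?z)) \<le> B"
            unfolding B_def
          proof (rule norm_integral_le_lborel[OF h_int[OF z]])
            show "integrable lborel (\<lambda>t. K * (1 + \<bar>t\<bar>) powr - (e0 + \<kappa>))"
              using \<kappa> by (intro integrable_mult_right integrable_one_plus_abs_powr)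
            show "norm (h ?z t) \<le> K * (1 + \<bar>t\<bar>) powr - (e0 + \<kappa>)" for t
            proof (rule order_trans[OF norm_h[of ?z t]])
              show "norm (f (?z + \<i> * of_real t)) * (1 + \<bar>t\<bar>) powr - Re (ex ?z)
                  \<le> K * (1 + \<bar>t\<bar>) powr - (e0 + \<kappa>)"
                unfolding Re_z \<zeta> using z by (intro mult_mono bdd) (auto simp: K)
            qed
          qed (use K in auto)
          thus ?thesis unfolding H_def C_def by simp
        qed
      qed
      let ?g = "\<lambda>t. norm (f (Complex c' t)) * (1 + \<bar>t\<bar>) powr - 1"
      let ?k = "\<lambda>t. norm (f (Complex c' t))^2 / (norm (f (Complex c' t)) + \<epsilon>) * (1 + \<bar>t\<bar>) powr - 1"
      \<comment> \<open>Here \<open>ex\<close> equals 1 and \<open>u\<close> is a nonnegative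
        multiple of the conjugate of \<open>f\<close>, so \<open>H\<close> at \<open>c'\<close> is
        the integral of a nonnegative real function: no cancellation occurs on the middle
        line.\<close>
      have heq: "h (of_real c') t = of_real (?k t)" for t
      proof -
        have "f (Complex c' t) * cnj (f (Complex c' t)) = of_real (norm (f (Complex c' t))^2)"
          by (rule complex_norm_square[symmetric])
        moreover have "exp (- L t) = of_real ((1 + \<bar>t\<bar>) powr - 1)"
          unfolding L_def by (simp add: powr_def exp_of_real flip: of_real_minus)
        moreover have "of_real c' + \<i> * of_real t = Complex c' t" by (simp add: complex_eq_iff)
        ultimately show ?thesis
          unfolding h_def ex_c' u_def by (simp add: mult_ac)
      qed
      have cont_abs: "continuous_on {- T..T} (\<lambda>t. norm (f (Complex c' t)))"
        using continuous_on_subset[OF cont_line[OF c', of 0], of "{-T..T}"] by (intro continuous_intros) simp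
      have k_int: "?k integrable_on {- T..T}"
        using pos by (intro integrable_continuous_interval continuous_intros cont_abs)
            (auto simp: less_imp_neq[symmetric])
      have g_int: "?g integrable_on {- T..T}"
        by (intro integrable_continuous_interval continuous_intros cont_abs) auto
      have "integral {- T..T} ?k \<le> C"
      proof -
        have "of_real c + of_real ((c' - c) / d) * of_real d = complex_of_real c'"
          using d0 by (simp flip: of_real_mult of_real_add)
        with nG have "norm (H (of_real c')) \<le> C" by (simp del: of_real_divide)
        also have "H (of_real c') = of_real (integral {- T..T} ?k)"
          unfolding H_def cbox_interval heq[THEN ext]
          using integral_linear[OF k_int bounded_linear_of_real[where 'a = complex]] by (simp only: o_def)
        finally show ?thesis by simp
      qed
      moreover have "integral {- T..T} ?g \<le> integral {- T..T} (\<lambda>t. ?k t + \<epsilon>)"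
      proof (rule integral_le[OF g_int])
        show "(\<lambda>t. ?k t + \<epsilon>) integrable_on {- T..T}" using k_int by (intro integrable_add) auto
        fix t
        let ?n = "norm (f (Complex c' t))" and ?w = "(1 + \<bar>t\<bar>) powr - 1"
        \<comment> \<open>Because (n - \<epsilon>)(n + \<epsilon>) \<le> n^2: regularising the phase
          costs at most \<epsilon> at each point.\<close>
        have "?n - \<epsilon> \<le> ?n^2 / (?n + \<epsilon>)"
          using pos[of t] by (simp add: field_simps power2_eq_square)
        hence "(?n - \<epsilon>) * ?w \<le> ?k t" by (rule mult_right_mono) simp
        moreover have "?w \<le> 1" using powr_mono[of "-1" 0 "1 + \<bar>t\<bar>"] by simp
        hence "\<epsilon> * ?w \<le> \<epsilon>" using mult_left_le[of ?w \<epsilon>] \<epsilon> by linarith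
        ultimately show "?g t \<le> ?k t + \<epsilon>" unfolding left_diff_distrib by linarith
      qed
      moreover have "integral {- T..T} (\<lambda>t. ?k t + \<epsilon>) = integral {- T..T} ?k + \<epsilon> * (2 * T)"
        using T by (subst integral_add[OF k_int]) auto
      ultimately show ?thesis by linarith
    qed
    show ?thesis
    proof (rule integrable_of_bounded_interval_integrals[where C = C])
      show "continuous_on UNIV (\<lambda>t. norm (f (Complex c' t)) * (1 + \<bar>t\<bar>) powr - 1)"
        using cont_line[OF c', of 0] by (intro continuous_intros) auto
      fix n :: nat
      have "((\<lambda>\<epsilon>. C + \<epsilon> * (2 * real n)) \<longlongrightarrow> C + 0 * (2 * real n)) (at_right 0)"
        by (intro tendsto_intros)
      hence "integral {- real n..real n} (\<lambda>t. norm (f (Complex c' t)) * (1 + \<bar>t\<bar>) powr - 1) \<le> C + 0 * (2 * real n)"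
        by (rule tendsto_lowerbound)
           (rule eventually_mono[OF eventually_at_right_less], rule main, simp_all)
      thus "integral {- real n..real n} (\<lambda>t. norm (f (Complex c' t)) * (1 + \<bar>t\<bar>) powr - 1) \<le> C" by simp
    qed auto
  qed
qed

subsection \<open>Fourier inversion\<close>

text \<open>Read off from the characteristic function of the standard normal law: up to sqrt(2 pi)
  the Gaussian is its own transform.\<close>

lemma std_normal_fourier:
  "(LBINT u. iexp (s * u) * of_real (std_normal_density u)) = of_real (sqrt (2 * pi) * std_normal_density s)"
proof -
  have "(LBINT u. iexp (s * u) * of_real (std_normal_density u)) = char std_normal_distribution s"
    unfolding char_def by (subst integral_density) (auto simp: scaleR_conv_of_real mult.commute)
  also have "\<dots> = of_real (sqrt (2 * pi) * std_normal_density s)"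
    unfolding char_std_normal_distribution by (simp add: std_normal_density_def)
  finally show ?thesis .
qed

lemma integrable_std_normal: "integrable lborel std_normal_density"
  using integrable_std_normal_moment[of 0] by simp

lemma integrable_prod_mult:
  fixes f g :: "real \<Rightarrow> real"
  assumes f: "integrable lborel f" and g: "integrable lborel g"
  shows "integrable (lborel \<Otimes>\<^sub>M lborel) (\<lambda>(x, y). f x * g y)"
proof (rule lborel_pair.Fubini_integrable)
  have [measurable]: "f \<in> borel_measurable borel" "g \<in> borel_measurable borel" using f g by auto
  show "(\<lambda>(x, y). f x * g y) \<in> borel_measurable (lborel \<Otimes>\<^sub>M lborel)" by measurable
  show "integrable lborel (\<lambda>x. LBINT y. norm (case (x, y) of (x, y) \<Rightarrow> f x * g y))"
    using f by (simp add: abs_mult)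
  show "AE x in lborel. integrable lborel (\<lambda>y. case (x, y) of (x, y) \<Rightarrow> f x * g y)"
    using g by simp
qed

text \<open>The Gaussian factor makes the double integral absolutely convergent, so the order can be
  exchanged. The inner integral over t is again a Gaussian, centred at \<open>y\<close> with width
  \<open>\<sigma>\<close>, and the substitution x = y + \<sigma> v turns the result into an average
  of \<open>h\<close> near \<open>y\<close>.\<close>

lemma gaussian_fourier:
  fixes h :: "real \<Rightarrow> real"
  assumes h: "integrable lborel h" and \<sigma>: "0 < \<sigma>"
  shows "(LBINT t. iexp (- t * y) * of_real (exp (- (\<sigma> * t)\<^sup>2 / 2)) * (LBINT x. iexp (t * x) * of_real (h x)))
       = of_real (2 * pi * (LBINT v. h (y + \<sigma> * v) * std_normal_density v))"
proof -
  have [measurable]: "h \<in> borel_measurable borel" using h by auto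
  let ?n = "\<lambda>t. exp (- (\<sigma> * t)\<^sup>2 / 2)"
  have n_eq: "?n t = sqrt (2 * pi) * std_normal_density (\<sigma> * t)" for t
    by (simp add: std_normal_density_def)
  have n_int: "integrable lborel ?n"
    unfolding n_eq using lborel_integrable_real_affine[OF integrable_std_normal, of \<sigma> 0] \<sigma>
    by (intro integrable_mult_right) simp
  let ?F = "\<lambda>t x. iexp (t * (x - y)) * of_real (?n t * h x)"
  have F_int: "integrable (lborel \<Otimes>\<^sub>M lborel) (\<lambda>(t, x). ?F t x)"
    by (rule Bochner_Integration.integrable_bound[OF integrable_prod_mult[OF n_int h]])
       (auto simp: norm_mult)
  have "(LBINT t. iexp (- t * y) * of_real (?n t) * (LBINT x. iexp (t * x) * of_real (h x)))
      = (LBINT t. LBINT x. ?F t x)"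
  proof (intro Bochner_Integration.integral_cong refl)
    fix t
    have "iexp (- t * y) * of_real (?n t) * (iexp (t * x) * of_real (h x)) = ?F t x" for x
    proof -
      have "iexp (t * (x - y)) = iexp (- t * y) * iexp (t * x)"
        unfolding exp_add[symmetric] by (simp add: algebra_simps)
      thus ?thesis by (simp only: of_real_mult mult_ac)
    qed
    thus "iexp (- t * y) * of_real (?n t) * (LBINT x. iexp (t * x) * of_real (h x)) = (LBINT x. ?F t x)"
      by (simp only: integral_mult_right_zero[symmetric])
  qed
  also have "\<dots> = (LBINT x. LBINT t. ?F t x)"
    by (rule lborel_pair.Fubini_integral[OF F_int, symmetric])
  also have "\<dots> = (LBINT x. of_real (2 * pi / \<sigma> * std_normal_density ((x - y) / \<sigma>) * h x))"
  proof (intro Bochner_Integration.integral_cong refl)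
    fix x
    have arg: "t * (x - y) = (x - y) / \<sigma> * (\<sigma> * t)" for t using \<sigma> by simp
    have affine: "(LBINT u. f u) = \<sigma> *\<^sub>R (LBINT t. f (\<sigma> * t))" for f :: "real \<Rightarrow> complex"
      using lborel_integral_real_affine[of \<sigma> f 0] \<sigma> by simp
    have "(LBINT t. ?F t x) = (LBINT t. iexp (t * (x - y)) * of_real (?n t)) * of_real (h x)"
      by (simp only: of_real_mult mult.assoc[symmetric] integral_mult_left_zero)
    also have "(LBINT t. iexp (t * (x - y)) * of_real (?n t))
       = of_real (sqrt (2 * pi)) * (LBINT t. iexp ((x - y) / \<sigma> * (\<sigma> * t)) * of_real (std_normal_density (\<sigma> * t)))"
      unfolding n_eq integral_mult_right_zero[symmetric] arg
      by (intro Bochner_Integration.integral_cong refl) (simp only: of_real_mult mult_ac)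
    also have "(LBINT t. iexp ((x - y) / \<sigma> * (\<sigma> * t)) * of_real (std_normal_density (\<sigma> * t)))
       = (1 / \<sigma>) *\<^sub>R (LBINT u. iexp ((x - y) / \<sigma> * u) * of_real (std_normal_density u))"
      unfolding affine[of "\<lambda>u. iexp ((x - y) / \<sigma> * u) * of_real (std_normal_density u)"] using \<sigma> by simp
    also have "(LBINT u. iexp ((x - y) / \<sigma> * u) * of_real (std_normal_density u))
       = complex_of_real (sqrt (2 * pi) * std_normal_density ((x - y) / \<sigma>))"
      by (rule std_normal_fourier)
    also have "complex_of_real (sqrt (2 * pi)) * ((1 / \<sigma>) *\<^sub>R complex_of_real (sqrt (2 * pi) * std_normal_density ((x - y) / \<sigma>)))
        = of_real (2 * pi / \<sigma> * std_normal_density ((x - y) / \<sigma>))"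
      by (simp add: scaleR_conv_of_real flip: of_real_mult)
    finally show "(LBINT t. ?F t x) = of_real (2 * pi / \<sigma> * std_normal_density ((x - y) / \<sigma>) * h x)"
      by simp
  qed
  also have "\<dots> = of_real (LBINT x. 2 * pi / \<sigma> * std_normal_density ((x - y) / \<sigma>) * h x)"
    by (rule integral_complex_of_real)
  also have "(LBINT x. 2 * pi / \<sigma> * std_normal_density ((x - y) / \<sigma>) * h x)
     = \<sigma> * (LBINT v. 2 * pi / \<sigma> * std_normal_density v * h (y + \<sigma> * v))"
  proof -
    have affine: "(LBINT x. f x) = \<sigma> * (LBINT v. f (y + \<sigma> * v))" for f :: "real \<Rightarrow> real"
      using lborel_integral_real_affine[of \<sigma> f y] \<sigma> by simp
    have arg: "(y + \<sigma> * v - y) / \<sigma> = v" for v using \<sigma> by simp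
    show ?thesis
      unfolding affine[of "\<lambda>x. 2 * pi / \<sigma> * std_normal_density ((x - y) / \<sigma>) * h x"] arg by (rule refl)
  qed
  also have "\<dots> = 2 * pi * (LBINT v. h (y + \<sigma> * v) * std_normal_density v)"
    unfolding integral_mult_right_zero[symmetric]
    by (intro Bochner_Integration.integral_cong refl) (use \<sigma> in simp)
  finally show ?thesis .
qed

text \<open>Both sides of \<open>gaussian_fourier\<close> are passed to the limit \<sigma>
  \<rightarrow> 0. On the left the integrable transform dominates; on the right the bound on
  \<open>h\<close> dominates and continuity at the single point \<open>y\<close> identifies the
  limit.\<close>

lemma fourier_inversion:
  fixes h :: "real \<Rightarrow> real"
  assumes h: "integrable lborel h" and bdd: "\<And>x. \<bar>h x\<bar> \<le> C" and cont: "isCont h y"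
    and \<phi>: "integrable lborel (\<lambda>t. LBINT x. iexp (t * x) * of_real (h x))"
  shows "(LBINT t. iexp (- t * y) * (LBINT x. iexp (t * x) * of_real (h x))) = of_real (2 * pi * h y)"
proof -
  have [measurable]: "h \<in> borel_measurable borel" using h by auto
  define \<phi> where "\<phi> t = (LBINT x. iexp (t * x) * of_real (h x))" for t
  have \<phi>_int: "integrable lborel \<phi>" using assms(4) unfolding \<phi>_def .
  have [measurable]: "\<phi> \<in> borel_measurable borel" using \<phi>_int by auto
  define \<sigma> where "\<sigma> k = 1 / real (Suc k)" for k
  have \<sigma>: "0 < \<sigma> k" "\<sigma> \<longlonglongrightarrow> 0" for k
    unfolding \<sigma>_def using LIMSEQ_inverse_real_of_nat by (simp_all add: inverse_eq_divide del: of_nat_Suc)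
  have "(\<lambda>k. LBINT t. iexp (- t * y) * of_real (exp (- (\<sigma> k * t)\<^sup>2 / 2)) * \<phi> t) \<longlonglongrightarrow> (LBINT t. iexp (- t * y) * \<phi> t)"
  proof (rule integral_dominated_convergence[where w = "\<lambda>t. norm (\<phi> t)"])
    show "AE t in lborel. (\<lambda>k. iexp (- t * y) * of_real (exp (- (\<sigma> k * t)\<^sup>2 / 2)) * \<phi> t) \<longlonglongrightarrow> iexp (- t * y) * \<phi> t"
    proof (rule AE_I2)
      fix t
      have "(\<lambda>k. iexp (- t * y) * of_real (exp (- (\<sigma> k * t)\<^sup>2 / 2)) * \<phi> t) \<longlonglongrightarrow>
          iexp (- t * y) * of_real (exp (- (0 * t)\<^sup>2 / 2)) * \<phi> t"
        by (intro tendsto_intros \<sigma>) auto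
      thus "(\<lambda>k. iexp (- t * y) * of_real (exp (- (\<sigma> k * t)\<^sup>2 / 2)) * \<phi> t) \<longlonglongrightarrow> iexp (- t * y) * \<phi> t" by simp
    qed
    show "AE t in lborel. norm (iexp (- t * y) * of_real (exp (- (\<sigma> k * t)\<^sup>2 / 2)) * \<phi> t) \<le> norm (\<phi> t)" for k
      by (intro AE_I2) (auto simp: norm_mult intro!: mult_left_le_one_le)
  qed (use \<phi>_int in auto)
  moreover have "(\<lambda>k. LBINT t. iexp (- t * y) * of_real (exp (- (\<sigma> k * t)\<^sup>2 / 2)) * \<phi> t) \<longlonglongrightarrow> of_real (2 * pi * h y)"
  proof -
    have "(\<lambda>k. LBINT v. h (y + \<sigma> k * v) * std_normal_density v) \<longlonglongrightarrow> (LBINT v. h y * std_normal_density v)"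
    proof (rule integral_dominated_convergence[where w = "\<lambda>v. C * std_normal_density v"])
      show "AE v in lborel. (\<lambda>k. h (y + \<sigma> k * v) * std_normal_density v) \<longlonglongrightarrow> h y * std_normal_density v"
      proof (rule AE_I2)
        fix v
        have "(\<lambda>k. y + \<sigma> k * v) \<longlonglongrightarrow> y + 0 * v" by (intro tendsto_intros \<sigma>)
        hence "(\<lambda>k. h (y + \<sigma> k * v)) \<longlonglongrightarrow> h y" by (intro isCont_tendsto_compose[OF cont]) simp
        thus "(\<lambda>k. h (y + \<sigma> k * v) * std_normal_density v) \<longlonglongrightarrow> h y * std_normal_density v"
          by (intro tendsto_intros)
      qed
      show "AE v in lborel. norm (h (y + \<sigma> k * v) * std_normal_density v) \<le> C * std_normal_density v" for k
        using bdd by (intro AE_I2) (auto simp: abs_mult intro!: mult_right_mono)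
    qed (use integrable_std_normal in auto)
    also have "(LBINT v. h y * std_normal_density v) = h y"
      using integral_std_normal_moment_even[of 0] by simp
    finally show ?thesis
      unfolding \<phi>_def gaussian_fourier[OF h \<sigma>(1)] by (intro tendsto_intros)
  qed
  ultimately show ?thesis unfolding \<phi>_def[symmetric] by (rule LIMSEQ_unique)
qed

text \<open>By translation invariance the L1 norm of k(y - x) in y is the same for all x, which
  gives integrability on the product and hence Fubini.\<close>

lemma
  fixes k g :: "real \<Rightarrow> real"
  assumes k: "integrable lborel k" and g: "integrable lborel g"
  shows integrable_convolution: "integrable lborel (\<lambda>y. LBINT x. k (y - x) * g x)"
    and fourier_convolution: "(LBINT y. iexp (t * y) * of_real (LBINT x. k (y - x) * g x))
         = (LBINT v. iexp (t * v) * of_real (k v)) * (LBINT x. iexp (t * x) * of_real (g x))"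
proof -
  have [measurable]: "k \<in> borel_measurable borel" "g \<in> borel_measurable borel" using k g by auto
  have shift: "integrable lborel (\<lambda>y. k (y - x))" for x
    using lborel_integrable_real_affine[OF k, of 1 "- x"] by simp
  have shift_eq: "(LBINT y. \<bar>k (y - x)\<bar>) = (LBINT y. \<bar>k y\<bar>)" for x
    using lborel_integral_real_affine[of 1 "\<lambda>y. \<bar>k y\<bar>" "- x"] by simp
  have int: "integrable (lborel \<Otimes>\<^sub>M lborel) (\<lambda>(x, y). k (y - x) * g x)"
  proof (rule lborel_pair.Fubini_integrable)
    show "integrable lborel (\<lambda>x. LBINT y. norm (case (x, y) of (x, y) \<Rightarrow> k (y - x) * g x))"
      using g by (simp add: abs_mult shift_eq)
    show "AE x in lborel. integrable lborel (\<lambda>y. case (x, y) of (x, y) \<Rightarrow> k (y - x) * g x)"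
      using shift by simp
  qed measurable
  from lborel_pair.integrable_snd[OF int]
  show "integrable lborel (\<lambda>y. LBINT x. k (y - x) * g x)" .
  let ?F = "\<lambda>x y. iexp (t * y) * of_real (k (y - x) * g x)"
  have intF: "integrable (lborel \<Otimes>\<^sub>M lborel) (\<lambda>(x, y). ?F x y)"
    by (rule Bochner_Integration.integrable_bound[OF int]) (auto simp: norm_mult)
  have "(LBINT y. iexp (t * y) * of_real (LBINT x. k (y - x) * g x)) = (LBINT y. LBINT x. ?F x y)"
    by (simp del: of_real_mult flip: integral_complex_of_real)
  also have "\<dots> = (LBINT x. LBINT y. ?F x y)"
    by (rule lborel_pair.Fubini_integral[OF intF])
  also have "\<dots> = (LBINT x. (LBINT v. iexp (t * v) * of_real (k v)) * (iexp (t * x) * of_real (g x)))"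
  proof (intro Bochner_Integration.integral_cong refl)
    fix x
    have "(LBINT y. ?F x y) = (LBINT v. ?F x (x + v))"
      using lborel_integral_real_affine[of 1 "\<lambda>y. ?F x y" x] by simp
    also have "\<dots> = (LBINT v. (iexp (t * v) * of_real (k v)) * (iexp (t * x) * of_real (g x)))"
      by (intro Bochner_Integration.integral_cong refl) (simp add: algebra_simps exp_add)
    finally show "(LBINT y. ?F x y) = (LBINT v. iexp (t * v) * of_real (k v)) * (iexp (t * x) * of_real (g x))"
      by simp
  qed
  also have "\<dots> = (LBINT v. iexp (t * v) * of_real (k v)) * (LBINT x. iexp (t * x) * of_real (g x))"
    by simp
  finally show "(LBINT y. iexp (t * y) * of_real (LBINT x. k (y - x) * g x))
         = (LBINT v. iexp (t * v) * of_real (k v)) * (LBINT x. iexp (t * x) * of_real (g x))" .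
qed

text \<open>An exponential density stripped of its rate factor, so that the transform is exactly 1 /
  (\<delta> - it), which is 1 / (\<theta> - s) for \<delta> = \<theta> - c1 and s = c1 + it.\<close>

definition exp_kernel :: "real \<Rightarrow> real \<Rightarrow> real" where
  "exp_kernel \<delta> v = indicator {0..} v * exp (- \<delta> * v)"

lemma exp_kernel_measurable [measurable]: "exp_kernel \<delta> \<in> borel_measurable borel"
  unfolding exp_kernel_def by measurable

lemma
  assumes "0 < \<delta>"
  shows integrable_exp_kernel: "integrable lborel (exp_kernel \<delta>)"
    and fourier_exp_kernel: "(LBINT v. iexp (t * v) * of_real (exp_kernel \<delta> v)) = 1 / (of_real \<delta> - \<i> * of_real t)"
proof -
  have "(\<integral>\<^sup>+v. ennreal (exp (- \<delta> * v)) * indicator {0..} v \<partial>lborel) = ennreal (0 - (- (exp (- \<delta> * 0)) / \<delta>))"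
  proof (rule nn_integral_FTC_atLeast)
    show "((\<lambda>v. - exp (- \<delta> * v) / \<delta>) has_real_derivative exp (- \<delta> * v)) (at v)" for v
      using assms by (auto intro!: derivative_eq_intros)
    show "((\<lambda>v. - exp (- \<delta> * v) / \<delta>) \<longlongrightarrow> 0) at_top" using assms by real_asymp
  qed auto
  thus int: "integrable lborel (exp_kernel \<delta>)"
    by (intro integrableI_nonneg) (auto simp: exp_kernel_def indicator_mult_ennreal mult.commute)
  let ?z = "of_real \<delta> - \<i> * of_real t"
  have z: "?z \<noteq> 0"   proof -
    have "Re ?z = \<delta>" by simp
    thus ?thesis using assms by (metis less_irrefl zero_complex.sel(1))
  qed
  let ?f = "\<lambda>v. exp (- ?z * of_real v)"
  have deriv: "((\<lambda>s. - exp (- w * s) / w) has_field_derivative exp (- w * s)) (at s)" if "w \<noteq> 0" for w s :: complex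
    using that by (auto intro!: derivative_eq_intros)
  \<comment> \<open>The kernel is 1 at the endpoint 0, which the open interval omits; the two
    integrands differ only there.\<close>
  have AE: "AE v in lborel. iexp (t * v) * of_real (exp_kernel \<delta> v) = indicator (einterval 0 \<infinity>) v *\<^sub>R ?f v"
    using AE_lborel_singleton[of 0]
    by eventually_elim (auto simp: exp_kernel_def indicator_def einterval_def exp_of_real[symmetric] algebra_simps exp_add[symmetric] exp_diff
       simp del: exp_of_real)
  have int': "integrable lborel (\<lambda>v. iexp (t * v) * of_real (exp_kernel \<delta> v))"
    by (rule Bochner_Integration.integrable_bound[OF int]) (auto simp: norm_mult)
  have si: "set_integrable lborel (einterval 0 \<infinity>) ?f"
    unfolding set_integrable_def
    by (subst integrable_cong_AE[OF _ _ AE, symmetric]) (use int' in auto)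
  have "(LBINT v. iexp (t * v) * of_real (exp_kernel \<delta> v)) = (LBINT v:einterval 0 \<infinity>. ?f v)"
    unfolding set_lebesgue_integral_def by (rule integral_cong_AE[OF _ _ AE]) auto
  also have "\<dots> = (LBINT v=0..\<infinity>. ?f v)" by (simp add: interval_lebesgue_integral_def)
  also have "\<dots> = 0 - (- 1 / ?z)"
  proof (rule interval_integral_FTC_integrable[where F = "\<lambda>v. - ?f v / ?z"])
    show "((\<lambda>v. - ?f v / ?z) has_vector_derivative ?f v) (at v)" for v
      by (rule has_vector_derivative_real_field[OF deriv[OF z]])
    show "isCont ?f v" for v by (intro continuous_intros)
    have "((\<lambda>v. - ?f v / ?z) \<longlongrightarrow> - ?f 0 / ?z) (at_right 0)"
      by (intro tendsto_intros) (rule z)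
    moreover have "?f 0 = 1" by simp
    ultimately show "(((\<lambda>v. - ?f v / ?z) \<circ> real_of_ereal) \<longlongrightarrow> - 1 / ?z) (at_right 0)"
      unfolding zero_ereal_def ereal_tendsto_simps1 by (simp only:)
    show "(((\<lambda>v. - ?f v / ?z) \<circ> real_of_ereal) \<longlongrightarrow> 0) (at_left \<infinity>)"
      unfolding ereal_tendsto_simps1
    proof (rule tendsto_norm_zero_cancel)
      have "((\<lambda>v. exp (- \<delta> * v) / norm ?z) \<longlongrightarrow> 0) at_top" using assms z by real_asymp
      thus "((\<lambda>v. norm (- ?f v / ?z)) \<longlongrightarrow> 0) at_top"
        by (simp add: norm_divide)
    qed
    show "set_integrable lborel (einterval 0 \<infinity>) ?f" by (rule si)
  qed auto
  finally show "(LBINT v. iexp (t * v) * of_real (exp_kernel \<delta> v)) = 1 / ?z" by simp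
qed

text \<open>As a function of x the jump of the kernel sits at x = y, a null set, so dominated
  convergence applies although \<open>g\<close> is merely integrable.\<close>

lemma isCont_exp_kernel_convolution:
  assumes g: "integrable lborel g" and \<delta>: "0 < \<delta>"
  shows "isCont (\<lambda>y. LBINT x. exp_kernel \<delta> (y - x) * g x) y"
  unfolding continuous_at_sequentially
proof (intro allI impI)
  have [measurable]: "g \<in> borel_measurable borel" using g by auto
  fix s :: "nat \<Rightarrow> real" assume s: "s \<longlonglongrightarrow> y"
  have "(\<lambda>n. LBINT x. exp_kernel \<delta> (s n - x) * g x) \<longlonglongrightarrow> (LBINT x. exp_kernel \<delta> (y - x) * g x)"
  proof (rule integral_dominated_convergence[where w = "\<lambda>x. \<bar>g x\<bar>"])
    show "AE x in lborel. (\<lambda>n. exp_kernel \<delta> (s n - x) * g x) \<longlonglongrightarrow> exp_kernel \<delta> (y - x) * g x"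
      using AE_lborel_singleton[of y]
    proof eventually_elim
      fix x assume x: "x \<noteq> y"
      have lim: "(\<lambda>n. s n - x) \<longlonglongrightarrow> y - x" using s by (intro tendsto_intros)
      have "(\<lambda>n. exp_kernel \<delta> (s n - x)) \<longlonglongrightarrow> exp_kernel \<delta> (y - x)"
      proof (cases "x < y")
        case True
        hence "\<forall>\<^sub>F n in sequentially. 0 < s n - x" using order_tendstoD(1)[OF lim, of 0] by simp
        hence "\<forall>\<^sub>F n in sequentially. exp (- \<delta> * (s n - x)) = exp_kernel \<delta> (s n - x)"
          by eventually_elim (auto simp: exp_kernel_def)
        moreover have "(\<lambda>n. exp (- \<delta> * (s n - x))) \<longlonglongrightarrow> exp (- \<delta> * (y - x))"
          using s by (intro tendsto_intros)
        moreover have "exp_kernel \<delta> (y - x) = exp (- \<delta> * (y - x))" using True by (simp add: exp_kernel_def)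
        ultimately show ?thesis by (simp only: Lim_transform_eventually)
      next
        case False
        hence "\<forall>\<^sub>F n in sequentially. s n - x < 0" using x order_tendstoD(2)[OF lim, of 0] by simp
        hence "\<forall>\<^sub>F n in sequentially. exp_kernel \<delta> (s n - x) = exp_kernel \<delta> (y - x)"
          by eventually_elim (use False x in \<open>auto simp: exp_kernel_def\<close>)
        thus ?thesis by (rule tendsto_eventually)
      qed
      thus "(\<lambda>n. exp_kernel \<delta> (s n - x) * g x) \<longlonglongrightarrow> exp_kernel \<delta> (y - x) * g x" by (intro tendsto_intros)
    qed
    show "AE x in lborel. norm (exp_kernel \<delta> (s n - x) * g x) \<le> \<bar>g x\<bar>" for n
      using \<delta> by (intro AE_I2) (auto simp: exp_kernel_def abs_mult indicator_def intro!: mult_left_le_one_le)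
  qed (use g in auto)
  thus "((\<lambda>y. LBINT x. exp_kernel \<delta> (y - x) * g x) \<circ> s) \<longlonglongrightarrow> (LBINT x. exp_kernel \<delta> (y - x) * g x)"
    by (simp add: o_def)
qed

subsection \<open>Truncated moment generating functions\<close>

lemma borel_measurable_mgf_vline:
  fixes X :: "'a \<Rightarrow> real"
  assumes X: "X \<in> borel_measurable M"
    and int: "integrable M (\<lambda>\<omega>. exp (a * X \<omega>))" "integrable M (\<lambda>\<omega>. exp (b * X \<omega>))"
    and c: "a < c" "c < b"
  shows "(\<lambda>t. mgf M X (Complex c t) :: complex) \<in> borel_measurable borel"
proof (rule borel_measurable_continuous_onI)
  have "continuous_on {s. a < Re s \<and> Re s < b} (mgf M X :: complex \<Rightarrow> complex)"
    using holomorphic_on_mgf[OF X int] by (rule holomorphic_on_imp_continuous_on)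
  thus "continuous_on UNIV (\<lambda>t. mgf M X (Complex c t) :: complex)"
    by (rule continuous_on_compose2) (use c in \<open>auto intro!: continuous_intros\<close>)
qed

lemma integrable_mgf_vline_weighted:
  fixes X :: "'a \<Rightarrow> real"
  assumes X: "X \<in> borel_measurable M"
    and int: "integrable M (\<lambda>\<omega>. exp (a * X \<omega>))" "integrable M (\<lambda>\<omega>. exp (b * X \<omega>))"
    and c: "a < c" "c < b" and c': "a < c'" "c' < b" and \<nu>: "0 < \<nu>"
    and Lp: "integrable lborel (\<lambda>t. norm (mgf M X (Complex c t)) powr (1 + \<nu>))"
  shows "integrable lborel (\<lambda>t. norm (mgf M X (Complex c' t)) * (1 + \<bar>t\<bar>) powr - 1)"
proof (rule integrable_vline_weighted[OF holomorphic_on_mgf[OF X int] _ c c' \<nu> Lp])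
  show "norm (mgf M X s) \<le> mgf M X a + mgf M X b" if "a < Re s" "Re s < b" for s :: complex
    using norm_mgf_le[of M X s] mgf_le_sum[OF X int, of "Re s"] that by simp
qed

text \<open>Compares the kernel 1 / (\<delta> - it) with the weight 1 / (1 + |t|). The modulus is at
  least \<delta> and at least |t|, hence at least half their sum.\<close>

lemma norm_diff_imaginary_ge:
  assumes "0 < \<delta>"
  shows "min 1 \<delta> / 2 * (1 + \<bar>t\<bar>) \<le> norm (of_real \<delta> - \<i> * of_real t)"
proof -
  have "\<delta> \<le> norm (of_real \<delta> - \<i> * of_real t)"
    using complex_Re_le_cmod[of "of_real \<delta> - \<i> * of_real t"] by simp
  moreover have "\<bar>t\<bar> \<le> norm (of_real \<delta> - \<i> * of_real t)"
    using abs_Im_le_cmod[of "of_real \<delta> - \<i> * of_real t"] by simp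
  moreover have "min 1 \<delta> * (1 + \<bar>t\<bar>) \<le> \<delta> + \<bar>t\<bar>"
  proof -
    have "min 1 \<delta> * \<bar>t\<bar> \<le> 1 * \<bar>t\<bar>" by (intro mult_right_mono) auto
    thus ?thesis unfolding distrib_left by simp
  qed
  ultimately show ?thesis by simp
qed

lemma integral_distributed_complex:
  fixes g :: "real \<Rightarrow> complex"
  assumes D: "distributed M lborel X (\<lambda>x. ennreal (f x))" and f: "\<And>x. 0 \<le> f x"
    and [measurable]: "g \<in> borel_measurable borel"
  shows "(\<integral>\<omega>. g (X \<omega>) \<partial>M) = (LBINT x. g x * of_real (f x))"
proof -
  have [measurable]: "f \<in> borel_measurable borel" using distributed_real_measurable[OF _ D] f by simp
  have [measurable]: "X \<in> borel_measurable M" using distributed_measurable[OF D] by simp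
  have "(\<integral>\<omega>. g (X \<omega>) \<partial>M) = integral\<^sup>L (distr M lborel X) g" by (simp add: integral_distr)
  also have "\<dots> = (LBINT x. f x *\<^sub>R g x)"
    unfolding distributed_distr_eq_density[OF D] using f by (intro integral_density) auto
  finally show ?thesis by (simp add: scaleR_conv_of_real mult.commute)
qed

text \<open>\<open>a\<close> and \<open>b\<close> are convergence points enclosing both
  \<open>c\<close> and \<open>c1\<close>, so that the MGF is bounded on a strip containing both
  lines. No upper limit is placed on \<open>\<theta>\<close>.\<close>

lemma Xi1_eq:
  assumes D: "distributed M lborel X (\<lambda>x. ennreal (f x))" and f: "\<And>x. 0 \<le> f x"
    and int: "integrable M (\<lambda>\<omega>. exp (a * X \<omega>))" "integrable M (\<lambda>\<omega>. exp (b * X \<omega>))"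
    and c: "a < c" "c < b" and c1: "a < c1" "c1 < b" and \<nu>: "0 < \<nu>"
    and Lp: "integrable lborel (\<lambda>t. norm (mgf M X (Complex c t)) powr (1 + \<nu>))"
    and \<theta>: "c1 < \<theta>"
  shows "vline_integrable (Xi1_integrand M X \<theta> y) c1"
    and "set_integrable lborel {..y} (\<lambda>x. exp (\<theta> * x) * f x)"
    and "Xi1 M X c1 \<theta> y = of_real (LBINT x:{..y}. exp (\<theta> * x) * f x)"
proof -
  have [measurable]: "f \<in> borel_measurable borel" using distributed_real_measurable[OF _ D] f by simp
  have X [measurable]: "X \<in> borel_measurable M" using distributed_measurable[OF D] by simp
  define \<delta> where "\<delta> = \<theta> - c1"
  have \<delta>: "0 < \<delta>" using \<theta> by (simp add: \<delta>_def)
  \<comment> \<open>The exponentially tilted density, whose Fourier transform is the MGF on the line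
    Re s = c1.\<close>
  define g where "g x = exp (c1 * x) * f x" for x
  define h where "h z = (LBINT x. exp_kernel \<delta> (z - x) * g x)" for z
  define \<phi> where "\<phi> t = mgf M X (Complex c1 t) / (of_real \<delta> - \<i> * of_real t)" for t
  have M_meas [measurable]: "(\<lambda>t. mgf M X (Complex c1 t) :: complex) \<in> borel_measurable borel"
    by (rule borel_measurable_mgf_vline[OF X int c1])
  have g0: "0 \<le> g x" for x using f by (simp add: g_def)
  have g_int: "integrable lborel g"
  proof -
    have "integrable M (\<lambda>\<omega>. exp (c1 * X \<omega>))" using integrable_exp_between[OF X int] c1 by simp
    hence "integrable lborel (\<lambda>x. f x * exp (c1 * x))"
      using distributed_integrable[OF D, of "\<lambda>x. exp (c1 * x)"] f by simp
    moreover have "g = (\<lambda>x. f x * exp (c1 * x))" by (rule ext) (simp add: g_def)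
    ultimately show ?thesis by (simp only:)
  qed
  have [measurable]: "g \<in> borel_measurable borel" using g_int by auto
  have g_fourier: "(LBINT x. iexp (t * x) * of_real (g x)) = mgf M X (Complex c1 t)" for t
  proof -
    have "mgf M X (Complex c1 t) = (LBINT x. exp (Complex c1 t * of_real x) * of_real (f x))"
      unfolding mgf_def by (rule integral_distributed_complex[OF D f]) simp
    also have "\<dots> = (LBINT x. iexp (t * x) * of_real (g x))"
    proof (intro Bochner_Integration.integral_cong refl)
      fix x
      have "exp (Complex c1 t * of_real x) = iexp (t * x) * of_real (exp (c1 * x))"
        unfolding exp_of_real[symmetric] exp_add[symmetric]
        by (rule arg_cong[where f = exp]) (simp add: complex_eq_iff)
      thus "exp (Complex c1 t * of_real x) * of_real (f x) = iexp (t * x) * of_real (g x)"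
        by (simp only: g_def of_real_mult mult.assoc)
    qed
    finally show ?thesis by simp
  qed
  have h_int: "integrable lborel h"
    unfolding h_def by (rule integrable_convolution[OF integrable_exp_kernel[OF \<delta>] g_int])
  have h_fourier: "(LBINT z. iexp (t * z) * of_real (h z)) = \<phi> t" for t
    unfolding h_def fourier_convolution[OF integrable_exp_kernel[OF \<delta>] g_int]
      fourier_exp_kernel[OF \<delta>] g_fourier \<phi>_def by simp
  have h_bdd: "\<bar>h z\<bar> \<le> (LBINT x. \<bar>g x\<bar>)" for z
  proof -
    have "\<bar>h z\<bar> \<le> (LBINT x. \<bar>exp_kernel \<delta> (z - x) * g x\<bar>)"
      unfolding h_def by (rule integral_abs_bound)
    also have "\<dots> \<le> (LBINT x. \<bar>g x\<bar>)"
      using \<delta> by (intro integral_mono' integrable_abs g_int)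
        (auto simp: exp_kernel_def abs_mult indicator_def intro!: mult_left_le_one_le)
    finally show ?thesis .
  qed
  \<comment> \<open>For x \<le> z the exponents add up to -\<delta>(z - x) + c1 x = -\<delta> z +
    \<theta> x, which turns the smoothed density into the truncated integral sought.\<close>
  have h_eq: "h z = exp (- \<delta> * z) * (LBINT x:{..z}. exp (\<theta> * x) * f x)" for z
    unfolding h_def set_lebesgue_integral_def integral_mult_right_zero[symmetric]
    by (intro Bochner_Integration.integral_cong refl)
       (auto simp: exp_kernel_def g_def \<delta>_def indicator_def algebra_simps simp flip: exp_add)
  have \<phi>_int: "integrable lborel \<phi>"
  proof (rule Bochner_Integration.integrable_bound)
    \<comment> \<open>Reciprocal of the constant in \<open>norm_diff_imaginary_ge\<close>.\<close>
    let ?K = "2 / min 1 \<delta>"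
    show "integrable lborel (\<lambda>t. ?K * (norm (mgf M X (Complex c1 t)) * (1 + \<bar>t\<bar>) powr - 1))"
      using integrable_mgf_vline_weighted[OF X int c c1 \<nu> Lp] by (rule integrable_mult_right)
    show "\<phi> \<in> borel_measurable lborel" unfolding \<phi>_def by measurable
    show "AE t in lborel. norm (\<phi> t) \<le> norm (?K * (norm (mgf M X (Complex c1 t)) * (1 + \<bar>t\<bar>) powr - 1))"
    proof (rule AE_I2)
      fix t
      have pos: "0 < min 1 \<delta> / 2 * (1 + \<bar>t\<bar>)" using \<delta> by (intro mult_pos_pos) auto
      have "norm (\<phi> t) \<le> norm (mgf M X (Complex c1 t)) / (min 1 \<delta> / 2 * (1 + \<bar>t\<bar>))"
        unfolding \<phi>_def norm_divide
        by (intro divide_left_mono norm_diff_imaginary_ge[OF \<delta>] mult_pos_pos pos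
            less_le_trans[OF pos norm_diff_imaginary_ge[OF \<delta>]]) simp
      also have "\<dots> = ?K * (norm (mgf M X (Complex c1 t)) * (1 + \<bar>t\<bar>) powr - 1)"
      proof -
        have "(1 + \<bar>t\<bar>) powr - 1 = 1 / (1 + \<bar>t\<bar>)" by (simp add: powr_minus_divide)
        thus ?thesis by (simp only: divide_divide_eq_right times_divide_eq_left times_divide_eq_right mult_1_right
          divide_divide_eq_left mult_ac)
      qed
      finally show "norm (\<phi> t) \<le> norm (?K * (norm (mgf M X (Complex c1 t)) * (1 + \<bar>t\<bar>) powr - 1))"
        by (simp only: real_norm_def)
    qed
  qed
  have integrand: "Xi1_integrand M X \<theta> y (Complex c1 t) = of_real (exp (\<delta> * y)) * (iexp (- t * y) * \<phi> t)" for t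
  proof -
    have s: "of_real \<theta> - Complex c1 t = of_real \<delta> - \<i> * of_real t"
      by (simp add: \<delta>_def complex_eq_iff)
    have "exp ((of_real \<delta> - \<i> * of_real t) * of_real y) = of_real (exp (\<delta> * y)) * iexp (- t * y)"
      unfolding exp_of_real[symmetric] exp_add[symmetric]
      by (rule arg_cong[where f = exp]) (simp add: complex_eq_iff)
    thus ?thesis unfolding Xi1_integrand_def s \<phi>_def by (simp only: times_divide_eq_right mult_ac)
  qed
  have it_int: "integrable lborel (\<lambda>t. iexp (- t * y) * \<phi> t)"
    by (rule Bochner_Integration.integrable_bound[OF \<phi>_int])
       (use \<phi>_int in \<open>auto simp: norm_mult\<close>)
  show "vline_integrable (Xi1_integrand M X \<theta> y) c1"
    unfolding vline_integrable_def integrand using it_int by (rule integrable_mult_right)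
  show "set_integrable lborel {..y} (\<lambda>x. exp (\<theta> * x) * f x)"
    unfolding set_integrable_def
  proof (rule Bochner_Integration.integrable_bound)
    show "integrable lborel (\<lambda>x. exp (\<delta> * y) * g x)" using g_int by simp
    show "AE x in lborel. norm (indicator {..y} x *\<^sub>R (exp (\<theta> * x) * f x)) \<le> norm (exp (\<delta> * y) * g x)"
    proof (rule AE_I2)
      fix x
      \<comment> \<open>Lowering the exponent from \<open>\<theta>\<close> to \<open>c1\<close>
        costs at most \<open>exp (\<delta> * y)\<close> on the half-line, which is why \<theta> may
        lie beyond the strip.\<close>
      have "exp (\<theta> * x) \<le> exp (\<delta> * y) * exp (c1 * x)" if "x \<le> y"
      proof -
        have "\<delta> * x \<le> \<delta> * y" using that \<delta> by simp
        thus ?thesis by (simp add: \<delta>_def algebra_simps flip: exp_add)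
      qed
      from mult_right_mono[OF this f[of x]]
      show "norm (indicator {..y} x *\<^sub>R (exp (\<theta> * x) * f x)) \<le> norm (exp (\<delta> * y) * g x)"
        using f[of x] by (auto simp: g_def indicator_def abs_mult)
    qed
  qed simp
  have inv: "(LBINT t. iexp (- t * y) * \<phi> t) = of_real (2 * pi * h y)"
  proof -
    have "isCont h y" unfolding h_def by (rule isCont_exp_kernel_convolution[OF g_int \<delta>])
    from fourier_inversion[OF h_int h_bdd this] \<phi>_int show ?thesis by (simp only: h_fourier)
  qed
  \<comment> \<open>The i from ds = i dt cancels the one in 1 / (2 pi i), and the 2 pi of the
    inversion formula removes the rest.\<close>
  have "Xi1 M X c1 \<theta> y = 1 / (2 * of_real pi) * (of_real (exp (\<delta> * y)) * of_real (2 * pi * h y))"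
    unfolding Xi1_def vline_integral_def integrand inv[symmetric] integral_mult_right_zero[symmetric]
    by simp
  also have "\<dots> = of_real (exp (\<delta> * y) * h y)" by simp
  also have "exp (\<delta> * y) * h y = (LBINT x:{..y}. exp (\<theta> * x) * f x)"
    unfolding h_eq by (simp flip: exp_add mult.assoc)
  finally show "Xi1 M X c1 \<theta> y = of_real (LBINT x:{..y}. exp (\<theta> * x) * f x)" .
qed

section \<open>Reflection of X, exchanging lower and upper half-lines\<close>

lemma set_integral_uminus_atMost:
  fixes g :: "real \<Rightarrow> real"
  shows "(LBINT x:{..- y}. g (- x)) = (LBINT x:{y..}. g x)"
  unfolding set_lebesgue_integral_def
  by (subst lborel_integral_real_affine[of "-1" _ 0])
     (auto intro!: Bochner_Integration.integral_cong simp: indicator_def)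

lemma set_integrable_uminus_atMost:
  fixes g :: "real \<Rightarrow> real"
  shows "set_integrable lborel {..- y} (\<lambda>x. g (- x)) \<longleftrightarrow> set_integrable lborel {y..} g"
  unfolding set_integrable_def
  by (subst lborel_integrable_real_affine_iff[of "-1" _ 0, symmetric])
     (auto intro!: Bochner_Integration.integrable_cong simp: indicator_def)

lemma mgf_uminus: "mgf M (\<lambda>\<omega>. - X \<omega>) s = mgf M X (- s)"
  by (simp add: mgf_def)

lemma (in prob_space) distributed_uminus:
  assumes "distributed M lborel X (f :: real \<Rightarrow> ennreal)"
  shows "distributed M lborel (\<lambda>\<omega>. - X \<omega>) (\<lambda>x. f (- x))"
  using distributed_affine[OF assms, of "-1" 0] by (simp add: divide_ennreal_def)

text \<open>Negating X, \<theta>, y and s together leaves (\<theta> - s) y unchanged and turns the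
  denominator \<theta> - s into s - \<theta>.\<close>

lemma Xi2_integrand_eq:
  "Xi2_integrand M X \<theta> y (Complex c t) = Xi1_integrand M (\<lambda>\<omega>. - X \<omega>) (- \<theta>) (- y) (Complex (- c) (- t))"
proof -
  have "- Complex (- c) (- t) = Complex c t"
    and "(of_real (- \<theta>) - Complex (- c) (- t)) * of_real (- y) = (of_real \<theta> - Complex c t) * of_real y"
    and "of_real (- \<theta>) - Complex (- c) (- t) = Complex c t - of_real \<theta>"
    by (simp_all add: complex_eq_iff algebra_simps)
  thus ?thesis unfolding Xi1_integrand_def Xi2_integrand_def mgf_uminus by (simp only:)
qed

lemma Xi2_eq_Xi1: "Xi2 M X c \<theta> y = Xi1 M (\<lambda>\<omega>. - X \<omega>) (- c) (- \<theta>) (- y)"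
  unfolding Xi1_def Xi2_def vline_integral_def Xi2_integrand_eq
  using lborel_integral_real_affine[of "-1" "\<lambda>t. Xi1_integrand M (\<lambda>\<omega>. - X \<omega>) (- \<theta>) (- y) (Complex (- c) t)" 0]
  by simp

lemma vline_integrable_Xi2_iff:
  "vline_integrable (Xi2_integrand M X \<theta> y) c \<longleftrightarrow>
   vline_integrable (Xi1_integrand M (\<lambda>\<omega>. - X \<omega>) (- \<theta>) (- y)) (- c)"
  unfolding vline_integrable_def Xi2_integrand_eq
  using lborel_integrable_real_affine_iff[of "-1" "\<lambda>t. Xi1_integrand M (\<lambda>\<omega>. - X \<omega>) (- \<theta>) (- y) (Complex (- c) t)" 0]
  by simp

lemma (in prob_space) Xi2_eq:
  assumes D: "distributed M lborel X (\<lambda>x. ennreal (f x))" and f: "\<And>x. 0 \<le> f x"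
    and int: "integrable M (\<lambda>\<omega>. exp (a * X \<omega>))" "integrable M (\<lambda>\<omega>. exp (b * X \<omega>))"
    and c: "a < c" "c < b" and c2: "a < c2" "c2 < b" and \<nu>: "0 < \<nu>"
    and Lp: "integrable lborel (\<lambda>t. norm (mgf M X (Complex c t)) powr (1 + \<nu>))"
    and \<theta>: "\<theta> < c2"
  shows "vline_integrable (Xi2_integrand M X \<theta> y) c2"
    and "set_integrable lborel {y..} (\<lambda>x. exp (\<theta> * x) * f x)"
    and "Xi2 M X c2 \<theta> y = of_real (LBINT x:{y..}. exp (\<theta> * x) * f x)"
proof -
  have "integrable lborel (\<lambda>t. norm (mgf M (\<lambda>\<omega>. - X \<omega>) (Complex (- c) t)) powr (1 + \<nu>))"
  proof -
    \<comment> \<open>The MGF of -X at -c + it is that of X at c - it, so the hypothesis carries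
      over by t \<rightarrow> -t.\<close>
    have "- Complex (- c) t = Complex c (0 + (- 1) * t)" for t by (simp add: complex_eq_iff)
    thus ?thesis unfolding mgf_uminus
      using lborel_integrable_real_affine[OF Lp, of "-1" 0] by simp
  qed
  note * = Xi1_eq[OF distributed_uminus[OF D] _ _ _ _ _ _ _ \<nu> this,
      of "- b" "- a" "- c2" "- \<theta>" "- y"]
  have 1: "vline_integrable (Xi1_integrand M (\<lambda>\<omega>. - X \<omega>) (- \<theta>) (- y)) (- c2)"
    by (rule *(1)) (use f int c c2 \<theta> in auto)
  thus "vline_integrable (Xi2_integrand M X \<theta> y) c2" unfolding vline_integrable_Xi2_iff .
  have 2: "set_integrable lborel {..- y} (\<lambda>x. exp (- \<theta> * x) * f (- x))"
    by (rule *(2)) (use f int c c2 \<theta> in auto)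
  thus "set_integrable lborel {y..} (\<lambda>x. exp (\<theta> * x) * f x)"
    using set_integrable_uminus_atMost[of y "\<lambda>x. exp (\<theta> * x) * f x"] by simp
  have 3: "Xi1 M (\<lambda>\<omega>. - X \<omega>) (- c2) (- \<theta>) (- y) = of_real (LBINT x:{..- y}. exp (- \<theta> * x) * f (- x))"
    by (rule *(3)) (use f int c c2 \<theta> in auto)
  thus "Xi2 M X c2 \<theta> y = of_real (LBINT x:{y..}. exp (\<theta> * x) * f x)"
    unfolding Xi2_eq_Xi1 using set_integral_uminus_atMost[of y "\<lambda>x. exp (\<theta> * x) * f x"] by simp
qed

section \<open>Densities of X + E and X - E\<close>

lemma (in prob_space) integrable_distributed_density:
  assumes D: "distributed M lborel X (\<lambda>x. ennreal (f x))" and f: "\<And>x. 0 \<le> f x"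
  shows "integrable lborel f"
  using distributed_integrable[OF D, of "\<lambda>_. 1"] f by simp

text \<open>The convolution theorem gives the density as an extended nonnegative integral. Since the
  exponential density is at most \<open>l\<close>, that integral is finite at every point and agrees
  with the real formula.\<close>

lemma (in prob_space) distributed_plus_exp:
  assumes D: "distributed M lborel X (\<lambda>x. ennreal (f x))" and f: "\<And>x. 0 \<le> f x"
    and E: "distributed M lborel E (\<lambda>x. ennreal (exponential_density l x))" and l: "0 < l"
    and indep: "indep_var borel X borel E"
  shows "distributed M lborel (\<lambda>\<omega>. X \<omega> + E \<omega>) (\<lambda>y. ennreal (density_plus_exp l f y))"
proof -
  have [measurable]: "f \<in> borel_measurable borel" using distributed_real_measurable[OF _ D] f by simp
  have "(\<integral>\<^sup>+v. ennreal (f (y - v)) * ennreal (exponential_density l v) \<partial>lborel)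
      = ennreal (density_plus_exp l f y)" for y
  proof -
    let ?g = "\<lambda>u. indicator {..y} u *\<^sub>R (l * exp (- l * (y - u)) * f u)"
    have "(\<integral>\<^sup>+v. ennreal (f (y - v)) * ennreal (exponential_density l v) \<partial>lborel)
        = (\<integral>\<^sup>+u. ennreal (f u) * ennreal (exponential_density l (y - u)) \<partial>lborel)"
      \<comment> \<open>Substitution v = y - u; the support v \<ge> 0 of the exponential density
        becomes the closed half-line u \<le> y.\<close>
      by (subst nn_integral_real_affine[where c = "-1" and t = y]) auto
    also have "\<dots> = (\<integral>\<^sup>+u. ennreal (?g u) \<partial>lborel)"
      using f by (intro nn_integral_cong)
        (auto simp: exponential_density_def indicator_def algebra_simps simp flip: ennreal_mult')
    also have "\<dots> = ennreal (integral\<^sup>L lborel ?g)"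
    proof (rule nn_integral_eq_integral)
      show "AE u in lborel. 0 \<le> ?g u" using f l by (auto intro!: AE_I2)
      show "integrable lborel ?g"
      proof (rule Bochner_Integration.integrable_bound)
        show "integrable lborel (\<lambda>u. l * f u)" using integrable_distributed_density[OF D f] by simp
        show "AE u in lborel. norm (?g u) \<le> norm (l * f u)"
        proof (rule AE_I2)
          fix u
          have "exp (- l * (y - u)) * f u \<le> 1 * f u" if "u \<le> y"
            using l f[of u] that by (intro mult_right_mono) auto
          thus "norm (?g u) \<le> norm (l * f u)"
            using l f[of u] by (auto simp: indicator_def abs_mult)
        qed
      qed simp
    qed
    finally show ?thesis by (simp add: density_plus_exp_def set_lebesgue_integral_def)
  qed
  with distributed_convolution[OF indep D E] show ?thesis by simp
qed

lemma density_minus_exp_eq: "density_minus_exp l f y = density_plus_exp l (\<lambda>x. f (- x)) (- y)"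
  unfolding density_plus_exp_def density_minus_exp_def
  using set_integral_uminus_atMost[of y "\<lambda>u. l * exp (- l * (u - y)) * f u", symmetric]
  by (simp add: algebra_simps)

text \<open>Writes X - E as -(-X + E), so the case of the sum applies to -X.\<close>

lemma (in prob_space) distributed_minus_exp:
  assumes D: "distributed M lborel X (\<lambda>x. ennreal (f x))" and f: "\<And>x. 0 \<le> f x"
    and E: "distributed M lborel E (\<lambda>x. ennreal (exponential_density l x))" and l: "0 < l"
    and indep: "indep_var borel X borel E"
  shows "distributed M lborel (\<lambda>\<omega>. X \<omega> - E \<omega>) (\<lambda>y. ennreal (density_minus_exp l f y))"
proof -
  have "indep_var borel (\<lambda>\<omega>. - X \<omega>) borel E"
    using indep_var_compose[OF indep, of uminus borel "\<lambda>x. x" borel] by (simp add: o_def)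
  hence "distributed M lborel (\<lambda>\<omega>. - X \<omega> + E \<omega>) (\<lambda>y. ennreal (density_plus_exp l (\<lambda>x. f (- x)) y))"
    using f by (intro distributed_plus_exp distributed_uminus[OF D] E l) auto
  from distributed_uminus[OF this] show ?thesis by (simp add: density_minus_exp_eq)
qed

text \<open>The prefactor cancels the rate and the part of the exponential depending on
  \<open>y\<close>, leaving \<open>exp (\<theta> * u)\<close> under the integral.\<close>

lemma exp_density_plus_exp:
  assumes "0 < \<theta>"
  shows "1 / \<theta> * exp (\<theta> * y) * density_plus_exp \<theta> f y = (LBINT x:{..y}. exp (\<theta> * x) * f x)"
  unfolding density_plus_exp_def set_lebesgue_integral_def integral_mult_right_zero[symmetric]
  using assms
  by (intro Bochner_Integration.integral_cong refl) (simp add: algebra_simps exp_diff)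

lemma exp_density_minus_exp:
  assumes "\<theta> < 0"
  shows "1 / \<bar>\<theta>\<bar> * exp (\<theta> * y) * density_minus_exp \<bar>\<theta>\<bar> f y = (LBINT x:{y..}. exp (\<theta> * x) * f x)"
  unfolding density_minus_exp_def set_lebesgue_integral_def integral_mult_right_zero[symmetric]
  using assms
  by (intro Bochner_Integration.integral_cong refl) (simp add: algebra_simps exp_diff)

section \<open>Conditional moment generating functions\<close>

lemma set_integral_distr_density:
  fixes g :: "real \<Rightarrow> real"
  assumes D: "distributed M lborel X (\<lambda>x. ennreal (f x))" and f: "\<And>x. 0 \<le> f x"
    and [measurable]: "A \<in> sets borel" "g \<in> borel_measurable borel"
  shows "(LINT x:A|distr M borel X. g x) = (LBINT x:A. g x * f x)"
proof -
  have [measurable]: "f \<in> borel_measurable borel" using distributed_real_measurable[OF _ D] f by simp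
  have [measurable]: "X \<in> borel_measurable M" using distributed_measurable[OF D] by simp
  have "distr M borel X = distr M lborel X" by (rule distr_cong) auto
  also have "\<dots> = density lborel (\<lambda>x. ennreal (f x))" by (rule distributed_distr_eq_density[OF D])
  finally have "distr M borel X = density lborel (\<lambda>x. ennreal (f x))" .
  thus ?thesis
    unfolding set_lebesgue_integral_def using f
    by (simp add: integral_density mult_ac)
qed

text \<open>Reconciles the open intervals of the conditional MGF with the closed half-lines of the
  truncated integrals; the law of X has no atoms.\<close>

lemma set_integral_lborel_remove_point:
  fixes g :: "real \<Rightarrow> real"
  assumes "A \<in> sets borel" "B \<in> sets borel" "A - {y} = B - {y}" "g \<in> borel_measurable borel"
  shows "(LBINT x:A. g x) = (LBINT x:B. g x)"
  unfolding set_lebesgue_integral_def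
proof (rule integral_cong_AE)
  show "AE x in lborel. indicator A x *\<^sub>R g x = indicator B x *\<^sub>R g x"
    using AE_lborel_singleton[of y] by eventually_elim (use assms(3) in \<open>auto simp: indicator_def\<close>)
qed (use assms in auto)

text \<open>The abscissas are quantified separately, even for the two endpoints in the last clause,
  so independence of their choice is part of the claim. The first clauses assert integrability as
  well, since a Bochner integral of a non-integrable function is 0 by convention. The clause on
  \<open>distributed\<close> certifies that the two pointwise formulas really are densities of X + E
  and X - E.\<close>

theorem theorem2p1:
  fixes M :: "'a measure" and X :: "'a \<Rightarrow> real" and f\<^sub>0 F\<^sub>0 :: "real \<Rightarrow> real" and \<alpha> \<beta> :: ereal
  assumes "prob_space M"
    and "X \<in> borel_measurable M"
    and "\<And>x. F\<^sub>0 x = cdf (distr M borel X) x"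
    and "\<And>x. 0 \<le> f\<^sub>0 x"
    and "distributed M lborel X (\<lambda>x. ennreal (f\<^sub>0 x))"
    and "0 < \<alpha>" and "0 < \<beta>"
    and "convergence_strip M X \<alpha> \<beta>"
    and "\<exists>c \<nu>. c \<in> einterval (- \<alpha>) \<beta> \<and> 0 < \<nu> \<and>
           integrable lborel (\<lambda>t. norm (mgf M X (Complex c t)) powr (1 + \<nu>))"
  shows "
    ((\<forall>y \<theta> c\<^sub>1. \<theta> \<in> einterval (- \<alpha>) \<infinity> \<longrightarrow> c\<^sub>1 \<in> einterval (- \<alpha>) (min \<beta> (ereal \<theta>)) \<longrightarrow>
        vline_integrable (Xi1_integrand M X \<theta> y) c\<^sub>1 \<and>
        set_integrable lborel {..y} (\<lambda>x. exp (\<theta> * x) * f\<^sub>0 x) \<and>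
        Xi1 M X c\<^sub>1 \<theta> y = of_real (LBINT x:{..y}. exp (\<theta> * x) * f\<^sub>0 x)) \<and>
     (\<forall>y \<theta> c\<^sub>2. \<theta> \<in> einterval (- \<infinity>) \<beta> \<longrightarrow> c\<^sub>2 \<in> einterval (max (- \<alpha>) (ereal \<theta>)) \<beta> \<longrightarrow>
        vline_integrable (Xi2_integrand M X \<theta> y) c\<^sub>2 \<and>
        set_integrable lborel {y..} (\<lambda>x. exp (\<theta> * x) * f\<^sub>0 x) \<and>
        Xi2 M X c\<^sub>2 \<theta> y = of_real (LBINT x:{y..}. exp (\<theta> * x) * f\<^sub>0 x)) \<and>
     (\<forall>y \<theta> c\<^sub>1 c\<^sub>2. \<theta> \<in> einterval (- \<alpha>) \<beta> \<longrightarrow>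
        c\<^sub>1 \<in> einterval (- \<alpha>) (min \<beta> (ereal \<theta>)) \<longrightarrow> c\<^sub>2 \<in> einterval (max (- \<alpha>) (ereal \<theta>)) \<beta> \<longrightarrow>
        Xi1 M X c\<^sub>1 \<theta> y + Xi2 M X c\<^sub>2 \<theta> y = of_real (mgf M X \<theta>))) \<and>
    (\<forall>\<theta> E. \<theta> \<noteq> 0 \<longrightarrow> distributed M lborel E (\<lambda>x. ennreal (exponential_density \<bar>\<theta>\<bar> x)) \<longrightarrow>
        prob_space.indep_var M borel X borel E \<longrightarrow>
        distributed M lborel (\<lambda>\<omega>. X \<omega> + E \<omega>) (\<lambda>y. ennreal (density_plus_exp \<bar>\<theta>\<bar> f\<^sub>0 y)) \<and>
        distributed M lborel (\<lambda>\<omega>. X \<omega> - E \<omega>) (\<lambda>y. ennreal (density_minus_exp \<bar>\<theta>\<bar> f\<^sub>0 y))) \<and>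
    ((\<forall>y \<theta> c\<^sub>1. 0 < \<theta> \<longrightarrow> c\<^sub>1 \<in> einterval (- \<alpha>) (min \<beta> (ereal \<theta>)) \<longrightarrow>
        Xi1 M X c\<^sub>1 \<theta> y = of_real (1 / \<theta> * exp (\<theta> * y) * density_plus_exp \<bar>\<theta>\<bar> f\<^sub>0 y)) \<and>
     (\<forall>y \<theta> c\<^sub>1. - \<alpha> < ereal \<theta> \<longrightarrow> \<theta> < 0 \<longrightarrow> c\<^sub>1 \<in> einterval (- \<alpha>) (min \<beta> (ereal \<theta>)) \<longrightarrow>
        Xi1 M X c\<^sub>1 \<theta> y =
          of_real (mgf M X \<theta> - 1 / \<bar>\<theta>\<bar> * exp (\<theta> * y) * density_minus_exp \<bar>\<theta>\<bar> f\<^sub>0 y))) \<and>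
    ((\<forall>y \<theta> c\<^sub>2. 0 < \<theta> \<longrightarrow> ereal \<theta> < \<beta> \<longrightarrow> c\<^sub>2 \<in> einterval (max (- \<alpha>) (ereal \<theta>)) \<beta> \<longrightarrow>
        Xi2 M X c\<^sub>2 \<theta> y =
          of_real (mgf M X \<theta> - 1 / \<theta> * exp (\<theta> * y) * density_plus_exp \<bar>\<theta>\<bar> f\<^sub>0 y)) \<and>
     (\<forall>y \<theta> c\<^sub>2. \<theta> < 0 \<longrightarrow> c\<^sub>2 \<in> einterval (max (- \<alpha>) (ereal \<theta>)) \<beta> \<longrightarrow>
        Xi2 M X c\<^sub>2 \<theta> y = of_real (1 / \<bar>\<theta>\<bar> * exp (\<theta> * y) * density_minus_exp \<bar>\<theta>\<bar> f\<^sub>0 y))) \<and>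
    ((\<forall>y \<theta> c\<^sub>1. 0 < F\<^sub>0 y \<longrightarrow> \<theta> \<in> einterval (- \<alpha>) \<infinity> \<longrightarrow>
        c\<^sub>1 \<in> einterval (- \<alpha>) (min \<beta> (ereal \<theta>)) \<longrightarrow>
        of_real (cond_mgf M X (- \<infinity>) (ereal y) \<theta>) = Xi1 M X c\<^sub>1 \<theta> y / of_real (F\<^sub>0 y)) \<and>
     (\<forall>y \<theta> c\<^sub>2. F\<^sub>0 y < 1 \<longrightarrow> \<theta> \<in> einterval (- \<infinity>) \<beta> \<longrightarrow>
        c\<^sub>2 \<in> einterval (max (- \<alpha>) (ereal \<theta>)) \<beta> \<longrightarrow>
        of_real (cond_mgf M X (ereal y) \<infinity> \<theta>) = Xi2 M X c\<^sub>2 \<theta> y / of_real (1 - F\<^sub>0 y))) \<and>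
    (\<forall>a b. a < b \<longrightarrow> 0 < F\<^sub>0 b - F\<^sub>0 a \<longrightarrow>
       (\<forall>\<theta> c\<^sub>1 c\<^sub>1'. \<theta> \<in> einterval (- \<alpha>) \<infinity> \<longrightarrow>
          c\<^sub>1 \<in> einterval (- \<alpha>) (min \<beta> (ereal \<theta>)) \<longrightarrow>
          c\<^sub>1' \<in> einterval (- \<alpha>) (min \<beta> (ereal \<theta>)) \<longrightarrow>
          of_real (cond_mgf M X (ereal a) (ereal b) \<theta>) =
            (Xi1 M X c\<^sub>1 \<theta> b - Xi1 M X c\<^sub>1' \<theta> a) / of_real (F\<^sub>0 b - F\<^sub>0 a)) \<and>
       (\<forall>\<theta> c\<^sub>2 c\<^sub>2'. \<theta> \<in> einterval (- \<infinity>) \<beta> \<longrightarrow>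
          c\<^sub>2 \<in> einterval (max (- \<alpha>) (ereal \<theta>)) \<beta> \<longrightarrow>
          c\<^sub>2' \<in> einterval (max (- \<alpha>) (ereal \<theta>)) \<beta> \<longrightarrow>
          of_real (cond_mgf M X (ereal a) (ereal b) \<theta>) =
            (Xi2 M X c\<^sub>2 \<theta> a - Xi2 M X c\<^sub>2' \<theta> b) / of_real (F\<^sub>0 b - F\<^sub>0 a)))"
proof -
  interpret prob_space M by fact
  note D = assms(5) and f = assms(4)
  have X [measurable]: "X \<in> borel_measurable M" by fact
  have [measurable]: "f\<^sub>0 \<in> borel_measurable borel" using distributed_real_measurable[OF _ D] f by simp
  define J where "J = einterval (- \<alpha>) \<beta>"
  have J_interior: "J = interior {\<theta>. integrable M (\<lambda>\<omega>. exp (\<theta> * X \<omega>))}"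
    using assms(8) by (simp add: J_def convergence_strip_def)
  have J_int: "integrable M (\<lambda>\<omega>. exp (\<theta> * X \<omega>))" if "\<theta> \<in> J" for \<theta>
    using that interior_subset unfolding J_interior by blast
  have J_open: "open J" unfolding J_interior by simp
  obtain c \<nu> where c: "c \<in> J" and \<nu>: "0 < \<nu>"
    and Lp: "integrable lborel (\<lambda>t. norm (mgf M X (Complex c t)) powr (1 + \<nu>))"
    using assms(9) unfolding J_def by blast
  \<comment> \<open>The MGF may diverge at the ends of the strip; openness of \<open>J\<close>
    supplies convergence points strictly on either side.\<close>
  have below: "\<exists>a\<in>J. a < x" and above: "\<exists>b\<in>J. x < b" if x: "x \<in> J" for x
  proof -
    obtain e where e: "0 < e" "ball x e \<subseteq> J" using openE[OF J_open x] by blast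
    have "x - e / 2 \<in> J" "x + e / 2 \<in> J" by (rule subsetD[OF e(2)], use e(1) in \<open>simp add: dist_real_def\<close>)+
    moreover have "x - e / 2 < x" "x < x + e / 2" using e(1) by simp_all
    ultimately show "\<exists>a\<in>J. a < x" "\<exists>b\<in>J. x < b" by blast+
  qed
  have bracket: "\<exists>a\<in>J. \<exists>b\<in>J. a < c \<and> c < b \<and> a < x \<and> x < b" if "x \<in> J" for x
  proof -
    have "min c x \<in> J" "max c x \<in> J" using c that by (simp_all add: min_def max_def)
    from below[OF this(1)] above[OF this(2)] show ?thesis by force
  qed
  define I1 where "I1 \<theta> y = (LBINT x:{..y}. exp (\<theta> * x) * f\<^sub>0 x)" for \<theta> y
  define I2 where "I2 \<theta> y = (LBINT x:{y..}. exp (\<theta> * x) * f\<^sub>0 x)" for \<theta> y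
  have Xi1: "vline_integrable (Xi1_integrand M X \<theta> y) c\<^sub>1"
      "set_integrable lborel {..y} (\<lambda>x. exp (\<theta> * x) * f\<^sub>0 x)"
      "Xi1 M X c\<^sub>1 \<theta> y = of_real (I1 \<theta> y)"
    if "c\<^sub>1 \<in> einterval (- \<alpha>) (min \<beta> (ereal \<theta>))" for c\<^sub>1 \<theta> y
  proof -
    have c1: "c\<^sub>1 \<in> J" "c\<^sub>1 < \<theta>" using that by (auto simp: J_def einterval_def)
    obtain a b where ab: "a \<in> J" "b \<in> J" "a < c" "c < b" "a < c\<^sub>1" "c\<^sub>1 < b"
      using bracket[OF c1(1)] by blast
    note * = Xi1_eq[OF D f J_int[OF ab(1)] J_int[OF ab(2)] ab(3-6) \<nu> Lp c1(2)]
    show "vline_integrable (Xi1_integrand M X \<theta> y) c\<^sub>1"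
      "set_integrable lborel {..y} (\<lambda>x. exp (\<theta> * x) * f\<^sub>0 x)"
      "Xi1 M X c\<^sub>1 \<theta> y = of_real (I1 \<theta> y)"
      unfolding I1_def by (rule *)+
  qed
  have Xi2: "vline_integrable (Xi2_integrand M X \<theta> y) c\<^sub>2"
      "set_integrable lborel {y..} (\<lambda>x. exp (\<theta> * x) * f\<^sub>0 x)"
      "Xi2 M X c\<^sub>2 \<theta> y = of_real (I2 \<theta> y)"
    if "c\<^sub>2 \<in> einterval (max (- \<alpha>) (ereal \<theta>)) \<beta>" for c\<^sub>2 \<theta> y
  proof -
    have c2: "c\<^sub>2 \<in> J" "\<theta> < c\<^sub>2" using that by (auto simp: J_def einterval_def)
    obtain a b where ab: "a \<in> J" "b \<in> J" "a < c" "c < b" "a < c\<^sub>2" "c\<^sub>2 < b"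
      using bracket[OF c2(1)] by blast
    note * = Xi2_eq[OF D f J_int[OF ab(1)] J_int[OF ab(2)] ab(3-6) \<nu> Lp c2(2)]
    show "vline_integrable (Xi2_integrand M X \<theta> y) c\<^sub>2"
      "set_integrable lborel {y..} (\<lambda>x. exp (\<theta> * x) * f\<^sub>0 x)"
      "Xi2 M X c\<^sub>2 \<theta> y = of_real (I2 \<theta> y)"
      unfolding I2_def by (rule *)+
  qed
  have split: "(LBINT x:A. exp (\<theta> * x) * f\<^sub>0 x) + (LBINT x:B. exp (\<theta> * x) * f\<^sub>0 x)
      = (LBINT x:C. exp (\<theta> * x) * f\<^sub>0 x)"
    if "set_integrable lborel C (\<lambda>x. exp (\<theta> * x) * f\<^sub>0 x)" "A \<in> sets borel" "B \<in> sets borel"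
      "A \<inter> B = {}" "A \<union> B = C" for A B C \<theta>
    using set_integral_Un[of A B lborel "\<lambda>x. exp (\<theta> * x) * f\<^sub>0 x"] that
      set_integrable_subset[OF that(1), of A] set_integrable_subset[OF that(1), of B] by auto
  have Ioi: "(LBINT x:{y<..}. exp (\<theta> * x) * f\<^sub>0 x) = I2 \<theta> y" for \<theta> y
    unfolding I2_def by (rule set_integral_lborel_remove_point[where y = y]) auto
  have Iio: "(LBINT x:{..<y}. exp (\<theta> * x) * f\<^sub>0 x) = I1 \<theta> y" for \<theta> y
    unfolding I1_def by (rule set_integral_lborel_remove_point[where y = y]) auto
  have total: "I1 \<theta> y + I2 \<theta> y = mgf M X \<theta>" if "\<theta> \<in> J" for \<theta> y
  proof -
    have "integrable lborel (\<lambda>x. f\<^sub>0 x * exp (\<theta> * x))"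
      using distributed_integrable[OF D, of "\<lambda>x. exp (\<theta> * x)"] J_int[OF that] f by simp
    hence "set_integrable lborel UNIV (\<lambda>x. exp (\<theta> * x) * f\<^sub>0 x)"
      by (simp add: set_integrable_def mult.commute)
    hence "I1 \<theta> y + I2 \<theta> y = (LBINT x:UNIV. exp (\<theta> * x) * f\<^sub>0 x)"
      unfolding Ioi[symmetric] I1_def by (rule split) auto
    also have "\<dots> = (\<integral>\<omega>. exp (\<theta> * X \<omega>) \<partial>M)"
      using distributed_integral[OF D, of "\<lambda>x. exp (\<theta> * x)"] f
      by (simp add: set_lebesgue_integral_def mult.commute)
    finally show ?thesis by (simp add: mgf_real)
  qed
  have cond: "cond_mgf M X a b \<theta> = (LBINT x:einterval a b. exp (\<theta> * x) * f\<^sub>0 x) /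
      (cdf_ext (distr M borel X) b - cdf_ext (distr M borel X) a)" for a b \<theta>
    unfolding cond_mgf_def by (subst set_integral_distr_density[OF D f]) auto
  have cond_below: "cond_mgf M X (- \<infinity>) (ereal y) \<theta> = I1 \<theta> y / F\<^sub>0 y" for y \<theta>
    unfolding cond einterval_eq by (simp add: Iio cdf_ext_def assms(3))
  have cond_above: "cond_mgf M X (ereal y) \<infinity> \<theta> = I2 \<theta> y / (1 - F\<^sub>0 y)" for y \<theta>
    unfolding cond einterval_eq by (simp add: Ioi cdf_ext_def assms(3))
  \<comment> \<open>For \<theta> beyond \<beta> the full MGF is infinite, so the difference is
    formed inside \<open>{..b}\<close>, where the integrand is integrable.\<close>
  have cond_1: "cond_mgf M X (ereal a) (ereal b) \<theta> = (I1 \<theta> b - I1 \<theta> a) / (F\<^sub>0 b - F\<^sub>0 a)"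
    if "a < b" "set_integrable lborel {..b} (\<lambda>x. exp (\<theta> * x) * f\<^sub>0 x)" for a b \<theta>
  proof -
    have "I1 \<theta> a + (LBINT x:{a<..b}. exp (\<theta> * x) * f\<^sub>0 x) = I1 \<theta> b"
      unfolding I1_def using that by (intro split) auto
    moreover have "(LBINT x:{a<..b}. exp (\<theta> * x) * f\<^sub>0 x) = (LBINT x:{a<..<b}. exp (\<theta> * x) * f\<^sub>0 x)"
      by (rule set_integral_lborel_remove_point[where y = b]) auto
    ultimately show ?thesis
      unfolding cond einterval_eq by (simp add: cdf_ext_def assms(3))
  qed
  \<comment> \<open>Likewise for \<theta> below -\<alpha>, with the splitting done inside
    \<open>{a..}\<close>.\<close>
  have cond_2: "cond_mgf M X (ereal a) (ereal b) \<theta> = (I2 \<theta> a - I2 \<theta> b) / (F\<^sub>0 b - F\<^sub>0 a)"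
    if "a < b" "set_integrable lborel {a..} (\<lambda>x. exp (\<theta> * x) * f\<^sub>0 x)" for a b \<theta>
  proof -
    have "(LBINT x:{a..<b}. exp (\<theta> * x) * f\<^sub>0 x) + I2 \<theta> b = I2 \<theta> a"
      unfolding I2_def using that by (intro split) auto
    moreover have "(LBINT x:{a..<b}. exp (\<theta> * x) * f\<^sub>0 x) = (LBINT x:{a<..<b}. exp (\<theta> * x) * f\<^sub>0 x)"
      by (rule set_integral_lborel_remove_point[where y = a]) auto
    ultimately show ?thesis
      unfolding cond einterval_eq by (simp add: cdf_ext_def assms(3))
  qed
  show ?thesis
    unfolding I1_def[symmetric] I2_def[symmetric]
  proof (intro conjI allI impI, goal_cases)
    case (1 y \<theta> c\<^sub>1) show ?case by (rule Xi1(1)[OF 1(2)])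
  next
    case (2 y \<theta> c\<^sub>1) show ?case by (rule Xi1(2)[OF 2(2)])
  next
    case (3 y \<theta> c\<^sub>1) show ?case by (rule Xi1(3)[OF 3(2)])
  next
    case (4 y \<theta> c\<^sub>2) show ?case by (rule Xi2(1)[OF 4(2)])
  next
    case (5 y \<theta> c\<^sub>2) show ?case by (rule Xi2(2)[OF 5(2)])
  next
    case (6 y \<theta> c\<^sub>2) show ?case by (rule Xi2(3)[OF 6(2)])
  next
    case (7 y \<theta> c\<^sub>1 c\<^sub>2)
    have "\<theta> \<in> J" using 7(1) by (simp add: J_def)
    thus ?case unfolding Xi1(3)[OF 7(2)] Xi2(3)[OF 7(3)] by (simp flip: total[of _ y])
  next
    case (8 \<theta> E) thus ?case by (intro distributed_plus_exp D f) auto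
  next
    case (9 \<theta> E) thus ?case by (intro distributed_minus_exp D f) auto
  next
    case (10 y \<theta> c\<^sub>1)
    show ?case
      using Xi1(3)[OF 10(2)] exp_density_plus_exp[OF 10(1), of y f\<^sub>0] 10(1) by (simp add: I1_def)
  next
    case (11 y \<theta> c\<^sub>1)
    have "\<theta> \<in> J" using 11 assms(7) by (auto simp: J_def einterval_def intro: order.strict_trans[of _ 0])
    thus ?case
      unfolding exp_density_minus_exp[OF 11(2)] Xi1(3)[OF 11(3)] by (simp add: I2_def flip: total[of _ y])
  next
    case (12 y \<theta> c\<^sub>2)
    have "- \<alpha> < 0" using assms(6) by (cases \<alpha>) auto
    hence "\<theta> \<in> J" using 12 by (auto simp: J_def einterval_def intro: order.strict_trans[of _ 0])
    thus ?case
      using exp_density_plus_exp[OF 12(1), of y f\<^sub>0] 12(1)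
      unfolding Xi2(3)[OF 12(3)] by (simp add: I1_def flip: total[of _ y])
  next
    case (13 y \<theta> c\<^sub>2)
    show ?case
      unfolding exp_density_minus_exp[OF 13(1)] Xi2(3)[OF 13(2)] by (simp add: I2_def)
  next
    case (14 y \<theta> c\<^sub>1) show ?case unfolding Xi1(3)[OF 14(3)] cond_below by simp
  next
    case (15 y \<theta> c\<^sub>2) show ?case unfolding Xi2(3)[OF 15(3)] cond_above by simp
  next
    case (16 a b \<theta> c\<^sub>1 c\<^sub>1')
    show ?case
      unfolding Xi1(3)[OF 16(4)] Xi1(3)[OF 16(5)] cond_1[OF 16(1) Xi1(2)[OF 16(4)]] by simp
  next
    case (17 a b \<theta> c\<^sub>2 c\<^sub>2')
    show ?case
      unfolding Xi2(3)[OF 17(4)] Xi2(3)[OF 17(5)] cond_2[OF 17(1) Xi2(2)[OF 17(4)]] by simp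
  qed
qed

end
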